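(* Let $T:X\to X$ be an adjoint operator on a separable dual Banach space $X$. Suppose that there is a dense set $X_0\subset X$ such that $T^kx\to0$ as $k\to\infty$ for each $x\in X_0$. The following statements are equivalent: (i) for every $n\in\mathbb{N}$, $T_n$ is $\mathcal{U}$-frequently hypercyclic and frequently recurrent; (ii) $T$ is reiteratively recurrent. In particular, the result holds if $T$ is a bounded linear operator on a separable reflexive Banach space $X$.
   Context: Banach spaces may be real or complex. $\mathbb{N}=\{1,2,\dots\}$, $\mathbb{N}_0=\mathbb{N}\cup\{0\}$. "Adjoint operator on a separable dual Banach space" means: $X=Y^*$ is the dual of a Banach space $Y$, $X$ is norm-separable, and $T=S^*$ for some bounded linear operator $S:Y\to Y$. Density and convergence are in norm. $T_n=T\oplus\cdots\oplus T$ ($n$ times) is the $n$-fold direct sum acting coordinatewise on $X^n=X\oplus\cdots\oplus X$ (with any norm defining the product topology). For an operator $S$, $N(x,A)=\{k\in\mathbb{N}_0: S^kx\in A\}$. For $A\subset\mathbb{N}_0$: $\underline{\operatorname{dens}}(A)=\liminf_{N\to\infty}\frac{\operatorname{card}(A\cap[0,N])}{N+1}$, $\overline{\operatorname{dens}}(A)=\limsup_{N\to\infty}\frac{\operatorname{card}(A\cap[0,N])}{N+1}$, $\overline{\operatorname{Bd}}(A)=\limsup_{N\to\infty}\left(\max_{m\ge0}\frac{\operatorname{card}(A\cap[m,m+N])}{N+1}\right)$. $S$ is $\mathcal{U}$-frequently hypercyclic if there is a vector $x$ with $\overline{\operatorname{dens}}(N(x,U))>0$ for every non-empty open set $U$.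 $S$ is frequently (resp. reiteratively) recurrent if the set of vectors $x$ such that $\underline{\operatorname{dens}}(N(x,U))>0$ (resp. $\overline{\operatorname{Bd}}(N(x,U))>0$) for every neighbourhood $U$ of $x$ is dense. *)

theory Defs
  imports "HOL-Analysis.Analysis"
begin

section \<open>Banach spaces over the real or complex field\<close>

text \<open>The scalar fields: normed fields isometrically isomorphic to the real or to the complex
  numbers. This treats both cases at once.\<close>

class real_or_complex = real_normed_field +
  assumes real_or_complex_embedding:
    "\<exists>\<phi>::'a \<Rightarrow> complex.
       (\<forall>a b. \<phi> (a + b) = \<phi> a + \<phi> b) \<and> (\<forall>a b. \<phi> (a * b) = \<phi> a * \<phi> b) \<and>
       (\<forall>r a. \<phi> (r *\<^sub>R a) = r *\<^sub>R \<phi> a) \<and> (\<forall>a. norm (\<phi> a) = norm a) \<and>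
       (range \<phi> = \<real> \<or> range \<phi> = UNIV)"

instance real :: real_or_complex
proof
  show "\<exists>\<phi>::real \<Rightarrow> complex.
       (\<forall>a b. \<phi> (a + b) = \<phi> a + \<phi> b) \<and> (\<forall>a b. \<phi> (a * b) = \<phi> a * \<phi> b) \<and>
       (\<forall>r a. \<phi> (r *\<^sub>R a) = r *\<^sub>R \<phi> a) \<and> (\<forall>a. norm (\<phi> a) = norm a) \<and>
       (range \<phi> = \<real> \<or> range \<phi> = UNIV)"
    by (rule exI[of _ complex_of_real]) (simp add: Reals_def scaleR_conv_of_real)
qed

instance complex :: real_or_complex
proof
  show "\<exists>\<phi>::complex \<Rightarrow> complex.
       (\<forall>a b. \<phi> (a + b) = \<phi> a + \<phi> b) \<and> (\<forall>a b. \<phi> (a * b) = \<phi> a * \<phi> b) \<and>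
       (\<forall>r a. \<phi> (r *\<^sub>R a) = r *\<^sub>R \<phi> a) \<and> (\<forall>a. norm (\<phi> a) = norm a) \<and>
       (range \<phi> = \<real> \<or> range \<phi> = UNIV)"
    by (rule exI[of _ "\<lambda>z. z"]) simp
qed

text \<open>The library has only real Banach spaces. A Banach space over \<open>'k\<close> is a type of class
  \<open>banach\<close> with a multiplication by scalars from \<open>'k\<close> that extends the real one and for which
  the norm is homogeneous.\<close>

definition banach_over :: "('k::real_or_complex \<Rightarrow> 'x::banach \<Rightarrow> 'x) \<Rightarrow> bool" where
  "banach_over smul \<longleftrightarrow>
     vector_space smul \<and>
     (\<forall>r x. smul (of_real r) x = r *\<^sub>R x) \<and>
     (\<forall>c x. norm (smul c x) = norm c * norm x)"

lemma banach_over_scaleR: "banach_over ((*\<^sub>R) :: real \<Rightarrow> 'x::banach \<Rightarrow> 'x)"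
  by (simp add: banach_over_def real_vector.vector_space_axioms)

text \<open>The library's bounded operators are real-linear; this is linearity over \<open>'k\<close>.\<close>

definition operator_over ::
    "('k::real_or_complex \<Rightarrow> 'x::banach \<Rightarrow> 'x) \<Rightarrow> ('x \<Rightarrow>\<^sub>L 'x) \<Rightarrow> bool" where
  "operator_over smul T \<longleftrightarrow> (\<forall>c x. T (smul c x) = smul c (T x))"

text \<open>The dual space consists of the bounded \<open>'k\<close>-linear functionals; its norm is the operator
  norm of the surrounding type.\<close>

definition dual_space ::
    "('k::real_or_complex \<Rightarrow> 'y::banach \<Rightarrow> 'y) \<Rightarrow> ('y \<Rightarrow>\<^sub>L 'k) set" where
  "dual_space smul = {f :: 'y \<Rightarrow>\<^sub>L 'k. \<forall>c y. f (smul c y) = c * f y}"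

lemma dual_space_scaleR: "dual_space ((*\<^sub>R) :: real \<Rightarrow> 'y::banach \<Rightarrow> 'y) = UNIV"
  by (auto simp: dual_space_def blinfun.scaleR_right)

definition adjoint_operator ::
    "('y::banach \<Rightarrow>\<^sub>L 'y) \<Rightarrow> ('y \<Rightarrow>\<^sub>L 'k::real_or_complex) \<Rightarrow> ('y \<Rightarrow>\<^sub>L 'k)" where
  "adjoint_operator S f = f o\<^sub>L S"

definition bidual_functional ::
    "('k::real_or_complex \<Rightarrow> 'x::banach \<Rightarrow> 'x) \<Rightarrow> (('x \<Rightarrow>\<^sub>L 'k) \<Rightarrow> 'k) \<Rightarrow> bool" where
  "bidual_functional smul \<Phi> \<longleftrightarrow>
     (\<forall>f\<in>dual_space smul. \<forall>g\<in>dual_space smul. \<Phi> (f + g) = \<Phi> f + \<Phi> g) \<and>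
     (\<forall>c. \<forall>f\<in>dual_space smul. \<Phi> (blinfun_mult_right c o\<^sub>L f) = c * \<Phi> f) \<and>
     (\<exists>C. \<forall>f\<in>dual_space smul. norm (\<Phi> f) \<le> C * norm f)"

text \<open>Reflexivity: the canonical embedding into the bidual is onto.\<close>

definition reflexive_space :: "('k::real_or_complex \<Rightarrow> 'x::banach \<Rightarrow> 'x) \<Rightarrow> bool" where
  "reflexive_space smul \<longleftrightarrow>
     (\<forall>\<Phi>. bidual_functional smul \<Phi> \<longrightarrow> (\<exists>x. \<forall>f\<in>dual_space smul. \<Phi> f = blinfun_apply f x))"

section \<open>Densities\<close>

definition lower_dens :: "nat set \<Rightarrow> ereal" where
  "lower_dens A = liminf (\<lambda>N. ereal (real (card (A \<inter> {0..N})) / real (N + 1)))"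

definition upper_dens :: "nat set \<Rightarrow> ereal" where
  "upper_dens A = limsup (\<lambda>N. ereal (real (card (A \<inter> {0..N})) / real (N + 1)))"

text \<open>The supremum over \<open>m\<close> is a maximum, since only finitely many values occur.\<close>

definition upper_Banach_dens :: "nat set \<Rightarrow> ereal" where
  "upper_Banach_dens A =
     limsup (\<lambda>N. SUP m. ereal (real (card (A \<inter> {m..m + N})) / real (N + 1)))"

section \<open>Dynamics\<close>

text \<open>The notions are stated for a map on the carrier of an abstract topology, so that they apply
  to dual spaces and to direct sums with a variable number of summands.\<close>

definition return_set :: "('a \<Rightarrow> 'a) \<Rightarrow> 'a \<Rightarrow> 'a set \<Rightarrow> nat set" where
  "return_set S x A = {k. (S ^^ k) x \<in> A}"

definition U_frequently_hypercyclic :: "'a topology \<Rightarrow> ('a \<Rightarrow> 'a) \<Rightarrow> bool" where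
  "U_frequently_hypercyclic \<tau> S \<longleftrightarrow>
     (\<exists>x\<in>topspace \<tau>. \<forall>U. openin \<tau> U \<and> U \<noteq> {} \<longrightarrow> upper_dens (return_set S x U) > 0)"

definition dense_in :: "'a topology \<Rightarrow> 'a set \<Rightarrow> bool" where
  "dense_in \<tau> A \<longleftrightarrow> A \<subseteq> topspace \<tau> \<and> \<tau> closure_of A = topspace \<tau>"

text \<open>\<open>U\<close> is a neighbourhood of \<open>x\<close> iff \<open>x\<close> lies in the interior of \<open>U\<close>.\<close>

definition frequently_recurrent :: "'a topology \<Rightarrow> ('a \<Rightarrow> 'a) \<Rightarrow> bool" where
  "frequently_recurrent \<tau> S \<longleftrightarrow>
     dense_in \<tau> {x \<in> topspace \<tau>. \<forall>U. x \<in> \<tau> interior_of U \<longrightarrow> lower_dens (return_set S x U) > 0}"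

definition reiteratively_recurrent :: "'a topology \<Rightarrow> ('a \<Rightarrow> 'a) \<Rightarrow> bool" where
  "reiteratively_recurrent \<tau> S \<longleftrightarrow>
     dense_in \<tau>
       {x \<in> topspace \<tau>. \<forall>U. x \<in> \<tau> interior_of U \<longrightarrow> upper_Banach_dens (return_set S x U) > 0}"

text \<open>Elements of the \<open>n\<close>-fold direct sum are families indexed by \<open>{..<n}\<close>, extended by
  \<open>undefined\<close>.\<close>

definition sum_topology_n :: "nat \<Rightarrow> 'a topology \<Rightarrow> (nat \<Rightarrow> 'a) topology" where
  "sum_topology_n n \<tau> = product_topology (\<lambda>_. \<tau>) {..<n}"

definition sum_operator_n :: "nat \<Rightarrow> ('a \<Rightarrow> 'a) \<Rightarrow> (nat \<Rightarrow> 'a) \<Rightarrow> (nat \<Rightarrow> 'a)" where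
  "sum_operator_n n T = (\<lambda>x. \<lambda>i\<in>{..<n}. T (x i))"

end

theory Submission
  imports Defs
begin

text \<open>
  The proof that (ii) implies (i) goes through invariant measures. Let the orbit of \<open>z\<close> visit a
  closed ball \<open>B\<close> at a set \<open>A\<close> of times with positive upper Banach density. Averaging over long
  windows in which \<open>A\<close> keeps a positive proportion yields a finitely additive, shift-invariant mean
  on the sets of times that does not vanish on \<open>A\<close> (\<open>invariant_mean_exists\<close>). On the compact space
  of ultrafilters of times such a mean is a genuine measure (\<open>stone_measure_exists\<close>). Along an
  ultrafilter on which it stays bounded, the orbit has a weak-star limit in \<open>X\<close>. Passing to this
  limit turns the shift into \<open>T\<close>, because an adjoint operator is weak-star continuous, and so
  transports the measure to a finite \<open>T\<close>-invariant measure on \<open>X\<close>. It charges \<open>B\<close>, because balls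
  are weak-star closed (\<open>invariant_measure_exists\<close>).

  Products of such measures are invariant under \<open>T\<^sub>n\<close>, and as reiteratively recurrent vectors are
  dense, every nonempty open box is charged by one of them. A maximal inequality shows that for an invariant measure almost every
  point of a set returns to it with positive lower density (\<open>AE_lower_dens_return_set_pos\<close>). Applied
  to a countable base this gives frequently recurrent vectors of \<open>T\<^sub>n\<close> in every box
  (\<open>sum_operator_n_frequently_recurrent\<close>). A product of measures is what makes the \<open>n\<close>
  coordinates return simultaneously; the orbits of \<open>n\<close> separate recurrent vectors need not do so.

  Upper frequent hypercyclicity of \<open>T\<^sub>n\<close> then follows from Baire's theorem. If \<open>y \<in> V\<close> returns to
  \<open>V\<close> with positive lower density, every nonempty open \<open>U\<close> contains a vector \<open>y + a\<close> with
  \<open>T\<^sub>n\<^sup>k a \<rightarrow> 0\<close>, whose orbit eventually follows that of \<open>y\<close>. So the frequency of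
  visits to \<open>V\<close> is bounded below independently of \<open>U\<close>, and generic vectors inherit this bound
  (\<open>sum_operator_n_U_frequently_hypercyclic\<close>).

  All this is carried out in the locale \<open>compact_functional_system\<close>, which isolates what is used of
  the weak-star topology. A dual space is an instance with the evaluation functionals; a reflexive
  space is one with all bounded functionals, which are norming by the Hahn-Banach theorem. The
  converse, from (i) to (ii), only compares densities for \<open>n = 1\<close>.
\<close>

section \<open>Ultrafilters and the Stone space\<close>

text \<open>Representing ultrafilters by the type of filters makes limits along them instances of
  \<open>tendsto\<close>.\<close>
definition ultrafilter :: "'i filter \<Rightarrow> bool" where
  "ultrafilter p \<longleftrightarrow> p \<noteq> bot \<and> (\<forall>P. eventually P p \<or> eventually (\<lambda>x. \<not> P x) p)"

lemma ultrafilter_not_eventually: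
  assumes "ultrafilter p"
  shows "\<not> eventually P p \<longleftrightarrow> eventually (\<lambda>x. \<not> P x) p"
proof
  assume "eventually (\<lambda>x. \<not> P x) p"
  show "\<not> eventually P p"
  proof
    assume "eventually P p"
    then have "eventually (\<lambda>x. False) p"
      using \<open>eventually (\<lambda>x. \<not> P x) p\<close> by eventually_elim auto
    then show False
      using assms by (simp add: ultrafilter_def trivial_limit_def)
  qed
qed (use assms in \<open>auto simp: ultrafilter_def\<close>)

lemma ultrafilter_filtermap: "ultrafilter p \<Longrightarrow> ultrafilter (filtermap f p)"
  by (simp add: ultrafilter_def filtermap_bot_iff eventually_filtermap)

lemma ultrafilter_principal_singleton: "ultrafilter (principal {x})"
  by (simp add: ultrafilter_def eventually_principal principal_eq_bot_iff)

text \<open>A minimal proper filter below \<open>F\<close>, which exists by Zorn's lemma, decides every predicate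
  \<open>P\<close>: otherwise intersecting it with the set of \<open>P\<close> would make it smaller.\<close>
lemma ultrafilter_exists:
  assumes "F \<noteq> (bot :: 'i filter)"
  obtains p where "p \<le> F" "ultrafilter p"
proof -
  define A where "A = {q. q \<noteq> bot \<and> q \<le> F}"
  have "\<exists>m\<in>A. \<forall>a\<in>A. m \<ge> a \<longrightarrow> a = m"
  proof (rule predicate_Zorn)
    show "partial_order_on A (relation_of (\<ge>) A)"
      by (rule partial_order_on_relation_ofI) auto
    fix C assume C: "C \<in> Chains (relation_of (\<ge>) A)"
    then have CA: "C \<subseteq> A" and chain: "\<And>x y. x \<in> C \<Longrightarrow> y \<in> C \<Longrightarrow> x \<le> y \<or> y \<le> x"
      by (auto simp: Chains_def relation_of_def)
    show "\<exists>u\<in>A. \<forall>a\<in>C. a \<ge> u"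
    proof (cases "C = {}")
      case True
      then show ?thesis using assms by (auto simp: A_def)
    next
      case False
      have base: "\<exists>x\<in>C. x \<le> inf G H" if "G \<in> C" "H \<in> C" for G H
        using chain[OF that] that by (metis le_inf_iff order_refl)
      have "Inf C \<noteq> bot"
      proof
        assume "Inf C = bot"
        then have "eventually (\<lambda>x. False) (Inf C)" by simp
        then obtain q where "q \<in> C" "eventually (\<lambda>x. False) q"
          using eventually_Inf_base[OF False base] by blast
        then show False using CA by (auto simp: A_def trivial_limit_def)
      qed
      moreover have "Inf C \<le> F"
        using False CA by (auto simp: A_def intro: Inf_lower2)
      ultimately show ?thesis by (auto simp: A_def intro!: bexI[of _ "Inf C"] Inf_lower)
    qed
  qed
  then obtain m where m: "m \<noteq> bot" "m \<le> F" and min: "\<And>a. a \<noteq> bot \<Longrightarrow> a \<le> m \<Longrightarrow> a = m"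
    by (force simp: A_def)
  have "eventually P m \<or> eventually (\<lambda>x. \<not> P x) m" for P
  proof (cases "inf m (principal {x. P x}) = bot")
    case True
    then have "eventually (\<lambda>x. False) (inf m (principal {x. P x}))" by simp
    then show ?thesis by (simp add: eventually_inf_principal)
  next
    case False
    then have "inf m (principal {x. P x}) = m" using min by simp
    moreover have "eventually P (inf m (principal {x. P x}))"
      by (simp add: eventually_inf_principal)
    ultimately show ?thesis by simp
  qed
  then have "ultrafilter m" using m by (simp add: ultrafilter_def)
  then show thesis using that m by blast
qed

text \<open>The image filter has a cluster point in \<open>C\<close>, and an ultrafilter converges to each of its
  cluster points.\<close>
lemma ultrafilter_convergent:
  fixes f :: "'i \<Rightarrow> 'b::topological_space"
  assumes p: "ultrafilter p" and C: "compact C" and ev: "eventually (\<lambda>i. f i \<in> C) p"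
  obtains l where "l \<in> C" "(f \<longlongrightarrow> l) p"
proof -
  let ?q = "filtermap f p"
  have q: "ultrafilter ?q" by (rule ultrafilter_filtermap[OF p])
  then have "?q \<noteq> bot" by (simp add: ultrafilter_def)
  moreover have "eventually (\<lambda>y. y \<in> C) ?q" using ev by (simp add: eventually_filtermap)
  ultimately obtain l where l: "l \<in> C" "inf (nhds l) ?q \<noteq> bot"
    using C by (auto simp: compact_filter le_principal)
  have "?q \<le> nhds l"
  proof (rule filter_leI)
    fix P assume P: "eventually P (nhds l)"
    show "eventually P ?q"
    proof (rule ccontr)
      assume "\<not> eventually P ?q"
      then have "eventually (\<lambda>x. \<not> P x) ?q"
        using ultrafilter_not_eventually[OF q] by blast
      then have "eventually (\<lambda>x. False) (inf (nhds l) ?q)"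
        using P unfolding eventually_inf by blast
      then show False using l by (simp add: trivial_limit_def)
    qed
  qed
  then show thesis using that l by (simp add: filterlim_def)
qed

text \<open>The basic clopen subsets of the Stone space of all ultrafilters on a set.\<close>
definition ultrafilters_on :: "'i set \<Rightarrow> 'i filter set" where
  "ultrafilters_on A = {p. ultrafilter p \<and> eventually (\<lambda>i. i \<in> A) p}"

lemma ultrafilters_on_subset: "ultrafilters_on A \<subseteq> ultrafilters_on UNIV"
  by (auto simp: ultrafilters_on_def)

lemma ultrafilters_on_empty: "ultrafilters_on {} = {}"
  by (auto simp: ultrafilters_on_def ultrafilter_def trivial_limit_def)

lemma ultrafilters_on_Int: "ultrafilters_on (A \<inter> B) = ultrafilters_on A \<inter> ultrafilters_on B"
  by (auto simp: ultrafilters_on_def eventually_conj_iff)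

lemma ultrafilters_on_Compl: "ultrafilters_on (- A) = ultrafilters_on UNIV - ultrafilters_on A"
  by (auto simp: ultrafilters_on_def simp flip: ultrafilter_not_eventually)

lemma ultrafilters_on_Un: "ultrafilters_on (A \<union> B) = ultrafilters_on A \<union> ultrafilters_on B"
proof -
  have "ultrafilters_on (- (- A \<inter> - B)) = ultrafilters_on A \<union> ultrafilters_on B"
    unfolding ultrafilters_on_Compl[of "- A \<inter> - B"] ultrafilters_on_Int
      ultrafilters_on_Compl[of A] ultrafilters_on_Compl[of B]
    using ultrafilters_on_subset by blast
  then show ?thesis by simp
qed

lemma ultrafilters_on_subset_iff: "ultrafilters_on A \<subseteq> ultrafilters_on B \<longleftrightarrow> A \<subseteq> B"
proof
  assume sub: "ultrafilters_on A \<subseteq> ultrafilters_on B"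
  show "A \<subseteq> B"
  proof
    fix x assume "x \<in> A"
    then have "principal {x} \<in> ultrafilters_on A"
      by (simp add: ultrafilters_on_def ultrafilter_principal_singleton eventually_principal)
    with sub have "principal {x} \<in> ultrafilters_on B" by blast
    then show "x \<in> B" by (simp add: ultrafilters_on_def eventually_principal)
  qed
qed (auto simp: ultrafilters_on_def elim: eventually_mono)

lemma inj_ultrafilters_on: "inj ultrafilters_on"
  by (rule injI) (metis order_antisym order_refl ultrafilters_on_subset_iff)

text \<open>Compactness of the Stone space, in the form needed for countable additivity: nonempty
  decreasing sets generate a proper filter, and any ultrafilter below it lies in all of them.\<close>
lemma ultrafilters_on_decseq_empty:
  fixes E :: "nat \<Rightarrow> 'i set"
  assumes "decseq E" and "(\<Inter>n. ultrafilters_on (E n)) = {}"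
  shows "\<exists>n. E n = {}"
proof (rule ccontr)
  assume ne: "\<nexists>n. E n = {}"
  let ?F = "INF n. principal (E n)"
  have "?F \<noteq> bot"
  proof
    assume "?F = bot"
    then have "eventually (\<lambda>x. False) ?F" by simp
    moreover have "\<exists>x\<in>UNIV. principal (E x) \<le> inf (principal (E a)) (principal (E b))" for a b
      using assms(1) by (intro bexI[of _ "max a b"]) (auto simp: decseq_def)
    ultimately have "\<exists>n. eventually (\<lambda>x. False) (principal (E n))"
      by (subst (asm) eventually_INF_base) auto
    then show False using ne by (auto simp: eventually_principal)
  qed
  then obtain p where p: "p \<le> ?F" "ultrafilter p" by (rule ultrafilter_exists)
  have "p \<in> ultrafilters_on (E n)" for n
  proof -
    have "p \<le> principal (E n)" using p(1) by (rule order_trans) (rule INF_lower, simp)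
    then show ?thesis using p(2) by (simp add: ultrafilters_on_def le_principal)
  qed
  then show False using assms(2) by blast
qed

text \<open>A finitely additive function on sets becomes countably additive on the clopen subsets of the
  Stone space, since by compactness a decreasing sequence of clopen sets with empty intersection is
  eventually empty. Caratheodory's theorem then extends it.\<close>
lemma stone_measure_exists:
  fixes d :: "'i set \<Rightarrow> real"
  assumes nonneg: "\<And>E. 0 \<le> d E"
    and add: "\<And>E F. E \<inter> F = {} \<Longrightarrow> d (E \<union> F) = d E + d F"
  obtains P where "space P = ultrafilters_on UNIV"
    and "sets P = sigma_sets (ultrafilters_on UNIV) (range ultrafilters_on)"
    and "\<And>E. emeasure P (ultrafilters_on E) = ennreal (d E)"
proof -
  let ?\<Omega> = "ultrafilters_on UNIV :: 'i filter set"
  let ?M = "range (ultrafilters_on :: 'i set \<Rightarrow> _)"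
  define f where "f A = ennreal (d (inv ultrafilters_on A))" for A
  have f: "f (ultrafilters_on E) = ennreal (d E)" for E
    by (simp add: f_def inv_f_f[OF inj_ultrafilters_on])
  have d0: "d {} = 0" using add[of "{}" "{}"] by simp
  interpret algebra ?\<Omega> ?M
  proof (subst algebra_iff_Un, intro conjI ballI)
    show "?M \<subseteq> Pow ?\<Omega>" using ultrafilters_on_subset by blast
    show "{} \<in> ?M" using ultrafilters_on_empty by (metis rangeI)
  next
    fix a assume "a \<in> ?M"
    then show "?\<Omega> - a \<in> ?M" by (auto simp flip: ultrafilters_on_Compl)
  next
    fix a b assume "a \<in> ?M" "b \<in> ?M"
    then show "a \<union> b \<in> ?M" by (auto simp flip: ultrafilters_on_Un)
  qed
  have "\<exists>\<mu>. (\<forall>s\<in>?M. \<mu> s = f s) \<and> measure_space ?\<Omega> (sigma_sets ?\<Omega> ?M) \<mu>"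
  proof (rule caratheodory_empty_continuous)
    show "positive ?M f" using f[of "{}"] by (simp add: positive_def ultrafilters_on_empty d0)
    show "additive ?M f"
      unfolding additive_def
    proof (intro ballI impI)
      fix x y assume "x \<in> ?M" "y \<in> ?M" and xy: "x \<inter> y = {}"
      then obtain E F where EF: "x = ultrafilters_on E" "y = ultrafilters_on F" by auto
      then have "ultrafilters_on (E \<inter> F) = ultrafilters_on {}"
        using xy by (simp add: ultrafilters_on_Int ultrafilters_on_empty)
      then have "E \<inter> F = {}" by (rule injD[OF inj_ultrafilters_on])
      then show "f (x \<union> y) = f x + f y"
        using nonneg by (simp add: EF f add flip: ultrafilters_on_Un)
    qed
    show "f A \<noteq> \<infinity>" for A by (simp add: f_def)
  next
    fix A assume A: "range A \<subseteq> ?M" "decseq A" "(\<Inter>i. A i) = {}"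
    then have "\<forall>i. \<exists>E. A i = ultrafilters_on E" by blast
    then obtain E where E: "\<And>i. A i = ultrafilters_on (E i)" by metis
    have "decseq E" using A(2) by (simp add: decseq_def E ultrafilters_on_subset_iff)
    moreover have "(\<Inter>n. ultrafilters_on (E n)) = {}" using A(3) by (simp add: E)
    ultimately obtain n where n: "E n = {}" using ultrafilters_on_decseq_empty by blast
    have "f (A i) = 0" if "i \<ge> n" for i
    proof -
      have "E i = {}" using \<open>decseq E\<close> n that by (auto simp: decseq_def)
      then show ?thesis by (simp add: E f d0)
    qed
    then show "(\<lambda>i. f (A i)) \<longlonglongrightarrow> 0"
      by (intro tendsto_eventually) (auto simp: eventually_sequentially)
  qed
  then obtain \<mu> where \<mu>: "\<forall>s\<in>?M. \<mu> s = f s" "measure_space ?\<Omega> (sigma_sets ?\<Omega> ?M) \<mu>" by blast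
  show thesis
  proof (rule that)
    let ?P = "measure_of ?\<Omega> (sigma_sets ?\<Omega> ?M) \<mu>"
    have sub: "?M \<subseteq> Pow ?\<Omega>" using ultrafilters_on_subset by blast
    show sp: "space ?P = ?\<Omega>" using sigma_sets_into_sp[OF sub] by (intro space_measure_of) auto
    show st: "sets ?P = sigma_sets ?\<Omega> ?M"
      using sigma_sets_into_sp[OF sub] by (subst sets_measure_of) (auto simp: sigma_sets_sigma_sets_eq[OF sub])
    show "emeasure ?P (ultrafilters_on E) = ennreal (d E)" for E
    proof (subst emeasure_measure_of[where \<Omega> = ?\<Omega> and A = "sigma_sets ?\<Omega> ?M" and \<mu> = \<mu>])
      show "positive (sets ?P) \<mu>" "countably_additive (sets ?P) \<mu>"
        using \<mu>(2) by (simp_all add: measure_space_def st)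
      show "sigma_sets ?\<Omega> ?M \<subseteq> Pow ?\<Omega>" using sigma_sets_into_sp[OF sub] by auto
      show "ultrafilters_on E \<in> sets ?P" by (auto simp: st)
      show "\<mu> (ultrafilters_on E) = ennreal (d E)" using \<mu>(1) f by auto
    qed simp
  qed
qed

section \<open>Shift-invariant means from positive upper Banach density\<close>

lemma upper_Banach_dens_pos_windows:
  assumes "upper_Banach_dens A > 0"
  obtains \<delta> :: real where "\<delta> > 0"
    "\<And>j. \<exists>N\<ge>j. \<exists>m. \<delta> * real (N + 1) \<le> real (card (A \<inter> {m..m + N}))"
proof -
  obtain \<delta>' where \<delta>': "0 < \<delta>'" "\<delta>' < upper_Banach_dens A"
    using assms dense by blast
  then obtain \<delta> where \<delta>: "\<delta>' = ereal \<delta>" by (cases \<delta>') auto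
  show thesis
  proof (rule that)
    show "\<delta> > 0" using \<delta>' \<delta> by simp
    fix j
    have "\<exists>\<^sub>F N in sequentially. (SUP m. ereal (real (card (A \<inter> {m..m + N})) / real (N + 1))) > \<delta>'"
    proof (rule ccontr)
      assume "\<not> ?thesis"
      then have "\<forall>\<^sub>F N in sequentially.
          (SUP m. ereal (real (card (A \<inter> {m..m + N})) / real (N + 1))) \<le> \<delta>'"
        by (simp add: not_frequently not_less)
      then have "upper_Banach_dens A \<le> \<delta>'"
        unfolding upper_Banach_dens_def by (rule Limsup_bounded)
      with \<delta>'(2) show False by simp
    qed
    then obtain N where N: "N \<ge> j"
      "(SUP m. ereal (real (card (A \<inter> {m..m + N})) / real (N + 1))) > \<delta>'"
      by (auto simp: frequently_sequentially)
    then obtain m where "ereal (real (card (A \<inter> {m..m + N})) / real (N + 1)) > \<delta>'"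
      by (auto simp: less_SUP_iff)
    then show "\<exists>N\<ge>j. \<exists>m. \<delta> * real (N + 1) \<le> real (card (A \<inter> {m..m + N}))"
      using N(1) by (intro exI[of _ N] conjI exI[of _ m]) (auto simp: \<delta> field_simps)
  qed
qed

text \<open>Shifting a set by one moves at most one element into or out of a window, which is negligible
  compared with long windows.\<close>
lemma card_Suc_preimage_window:
  "\<bar>real (card (Suc -` E \<inter> {m..m + N})) - real (card (E \<inter> {m..m + N}))\<bar> \<le> 1"
proof -
  let ?B = "E \<inter> {Suc m..Suc (m + N)}"
  have "card (Suc -` E \<inter> {m..m + N}) = card (Suc ` (Suc -` E \<inter> {m..m + N}))"
    by (simp add: card_image)
  also have "Suc ` (Suc -` E \<inter> {m..m + N}) = ?B"
  proof (rule set_eqI)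
    show "x \<in> Suc ` (Suc -` E \<inter> {m..m + N}) \<longleftrightarrow> x \<in> ?B" for x
      by (cases x) auto
  qed
  finally have eq: "card (Suc -` E \<inter> {m..m + N}) = card ?B" .
  have "card ?B \<le> card (insert (Suc (m + N)) (E \<inter> {m..m + N}))"
    by (rule card_mono) auto
  also have "\<dots> \<le> Suc (card (E \<inter> {m..m + N}))" by (simp add: card_insert_if)
  finally have 1: "card ?B \<le> Suc (card (E \<inter> {m..m + N}))" .
  have "card (E \<inter> {m..m + N}) \<le> card (insert m ?B)"
    by (rule card_mono) auto
  also have "\<dots> \<le> Suc (card ?B)" by (simp add: card_insert_if)
  finally have 2: "card (E \<inter> {m..m + N}) \<le> Suc (card ?B)" .
  show ?thesis using 1 2 unfolding eq by linarith
qed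

text \<open>The mean is the limit, along an ultrafilter, of the proportions in windows of growing length
  in which \<open>A\<close> keeps its density.\<close>
lemma invariant_mean_exists:
  assumes "upper_Banach_dens A > 0"
  obtains d :: "nat set \<Rightarrow> real" where "\<And>E. 0 \<le> d E"
    and "\<And>E F. E \<inter> F = {} \<Longrightarrow> d (E \<union> F) = d E + d F"
    and "\<And>E. d (Suc -` E) = d E" and "d A > 0"
proof -
  obtain \<delta> :: real where \<delta>: "\<delta> > 0"
    "\<And>j. \<exists>N\<ge>j. \<exists>m. \<delta> * real (N + 1) \<le> real (card (A \<inter> {m..m + N}))"
    using upper_Banach_dens_pos_windows[OF assms] by blast
  then obtain N m where Nm: "\<And>j. N j \<ge> j"
    "\<And>j. \<delta> * real (N j + 1) \<le> real (card (A \<inter> {m j..m j + N j}))"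
    by metis
  define r where "r E j = real (card (E \<inter> {m j..m j + N j})) / real (N j + 1)" for E j
  obtain p where p: "p \<le> (sequentially :: nat filter)" "ultrafilter p"
    using ultrafilter_exists[OF sequentially_bot] by blast
  then have pbot: "p \<noteq> bot" by (simp add: ultrafilter_def)
  have "\<exists>l. (r E \<longlongrightarrow> l) p" for E
  proof (rule ultrafilter_convergent[OF p(2)])
    have "r E j \<in> {0..1}" for j
    proof -
      have "card (E \<inter> {m j..m j + N j}) \<le> card {m j..m j + N j}" by (rule card_mono) auto
      then show ?thesis by (simp add: r_def)
    qed
    then show "\<forall>\<^sub>F i in p. r E i \<in> {0..1::real}" by simp
  qed auto
  then obtain d where d: "\<And>E. (r E \<longlongrightarrow> d E) p" by metis
  have Nlim: "((\<lambda>j. 1 / real (N j + 1)) \<longlongrightarrow> 0) p"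
  proof (rule filterlim_mono[OF _ order_refl p(1)])
    have "filterlim N at_top sequentially"
      by (rule filterlim_at_top_mono[OF filterlim_ident]) (simp add: Nm)
    then have "filterlim (\<lambda>j. real (N j + 1)) at_top sequentially"
      by (intro filterlim_compose[OF filterlim_real_sequentially]
            filterlim_compose[OF filterlim_add_const_nat_at_top])
    then show "(\<lambda>j. 1 / real (N j + 1)) \<longlonglongrightarrow> 0"
      by (rule real_tendsto_divide_at_top[OF tendsto_const])
  qed
  show thesis
  proof (rule that[of d])
    show "0 \<le> d E" for E
      by (rule tendsto_lowerbound[OF d _ pbot]) (simp add: r_def)
  next
    fix E F :: "nat set" assume EF: "E \<inter> F = {}"
    have "r (E \<union> F) j = r E j + r F j" for j
    proof -
      have "card ((E \<union> F) \<inter> {m j..m j + N j})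
          = card (E \<inter> {m j..m j + N j}) + card (F \<inter> {m j..m j + N j})"
        unfolding Int_Un_distrib2 by (rule card_Un_disjoint) (use EF in auto)
      then show ?thesis by (simp add: r_def add_divide_distrib)
    qed
    then have "(r (E \<union> F) \<longlongrightarrow> d E + d F) p"
      using tendsto_add[OF d d, of E F] by presburger
    then show "d (E \<union> F) = d E + d F" using tendsto_unique[OF pbot d] by blast
  next
    fix E :: "nat set"
    have "((\<lambda>j. r (Suc -` E) j - r E j) \<longlongrightarrow> 0) p"
    proof (rule Lim_null_comparison[OF _ Nlim], rule always_eventually, rule allI)
      fix j
      have "norm (r (Suc -` E) j - r E j)
          = \<bar>real (card (Suc -` E \<inter> {m j..m j + N j})) - real (card (E \<inter> {m j..m j + N j}))\<bar>
            / real (N j + 1)"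
        by (simp add: r_def flip: diff_divide_distrib)
      also have "\<dots> \<le> 1 / real (N j + 1)"
        by (intro divide_right_mono card_Suc_preimage_window) simp
      finally show "norm (r (Suc -` E) j - r E j) \<le> 1 / real (N j + 1)" .
    qed
    moreover have "((\<lambda>j. r (Suc -` E) j - r E j) \<longlongrightarrow> d (Suc -` E) - d E) p"
      by (intro tendsto_diff d)
    ultimately show "d (Suc -` E) = d E" using tendsto_unique[OF pbot] by fastforce
  next
    have "\<delta> \<le> d A"
      by (rule tendsto_lowerbound[OF d _ pbot]) (use Nm(2) in \<open>simp add: r_def field_simps\<close>)
    then show "d A > 0" using \<delta>(1) by simp
  qed
qed

text \<open>The shift of times acts on the Stone space by \<open>filtermap Suc\<close>; invariance of the mean says
  that it preserves the measure of the clopen sets, which are a generator stable under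
  intersection.\<close>
lemma filtermap_Suc_preserves_stone_measure:
  assumes sp: "space P = ultrafilters_on UNIV"
    and st: "sets P = sigma_sets (ultrafilters_on UNIV) (range ultrafilters_on)"
    and em: "\<And>E. emeasure P (ultrafilters_on E) = ennreal (d E)"
    and d: "\<And>E. d (Suc -` E) = d E"
  shows "filtermap Suc \<in> measurable P P" and "distr P P (filtermap Suc) = P"
proof -
  let ?\<Omega> = "ultrafilters_on UNIV :: nat filter set"
  let ?G = "range (ultrafilters_on :: nat set \<Rightarrow> _)"
  have G: "?G \<subseteq> Pow ?\<Omega>" using ultrafilters_on_subset by blast
  have pre: "filtermap Suc -` ultrafilters_on E \<inter> ?\<Omega> = ultrafilters_on (Suc -` E)" for E
    by (auto simp: ultrafilters_on_def eventually_filtermap ultrafilter_filtermap)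
  show meas: "filtermap Suc \<in> measurable P P"
  proof (rule measurable_sigma_sets[OF st G])
    show "filtermap Suc \<in> space P \<rightarrow> ?\<Omega>"
      by (auto simp: sp ultrafilters_on_def ultrafilter_filtermap)
    show "filtermap Suc -` y \<inter> space P \<in> sets P" if "y \<in> ?G" for y
      using that by (auto simp: sp pre st)
  qed
  show "distr P P (filtermap Suc) = P"
  proof (rule measure_eqI_generator_eq[where \<Omega> = ?\<Omega> and E = ?G and A = "\<lambda>_. ?\<Omega>"])
    show "Int_stable ?G"
      by (auto simp: Int_stable_def simp flip: ultrafilters_on_Int)
    show "emeasure (distr P P (filtermap Suc)) Y = emeasure P Y" if Y_in: "Y \<in> ?G" for Y
    proof -
      obtain E where Y: "Y = ultrafilters_on E" using Y_in by blast
      have "emeasure (distr P P (filtermap Suc)) Y = emeasure P (filtermap Suc -` Y \<inter> space P)"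
        using Y_in by (intro emeasure_distr meas) (auto simp: st)
      then show ?thesis by (simp add: Y sp pre em d)
    qed
    show "emeasure (distr P P (filtermap Suc)) ?\<Omega> \<noteq> \<infinity>"
    proof -
      have "?\<Omega> \<in> sets P" by (auto simp: st)
      then show ?thesis by (simp add: emeasure_distr[OF meas] sp pre em)
    qed
  qed (use G in \<open>auto simp: st\<close>)
qed

section \<open>Almost every point of a set returns to it with positive lower density\<close>

lemma sum_lessThan_split:
  fixes f :: "nat \<Rightarrow> 'a::comm_monoid_add"
  shows "(\<Sum>k<a + b. f k) = (\<Sum>k<a. f k) + (\<Sum>k<b. f (a + k))"
  by (induction b) (simp_all add: ac_simps)

text \<open>Cut \<open>{..<m}\<close> greedily into blocks of length at most \<open>L\<close> on each of which the average is at
  most \<open>\<epsilon>\<close>. Only the last, incomplete block escapes the estimate; it contributes at most \<open>L\<close>.\<close>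
lemma sum_le_of_good_blocks:
  fixes g :: "nat \<Rightarrow> real"
  assumes bd: "\<And>i. g i \<le> 1" and "\<epsilon> \<ge> 0"
    and block: "\<And>i. \<exists>n. 1 \<le> n \<and> n \<le> L \<and> (\<Sum>k<n. g (i + k)) \<le> \<epsilon> * real n"
  shows "(\<Sum>k<m. g (i + k)) \<le> \<epsilon> * real m + real L"
proof (induction m arbitrary: i rule: less_induct)
  case (less m)
  show ?case
  proof (cases "m \<le> L")
    case True
    have "(\<Sum>k<m. g (i + k)) \<le> (\<Sum>k<m. 1)" by (intro sum_mono bd)
    also have "\<dots> \<le> \<epsilon> * real m + real L" using True \<open>\<epsilon> \<ge> 0\<close> by (simp add: add_increasing)
    finally show ?thesis .
  next
    case False
    obtain n where n: "1 \<le> n" "n \<le> L" "(\<Sum>k<n. g (i + k)) \<le> \<epsilon> * real n" using block by blast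
    have "(\<Sum>k<m. g (i + k)) = (\<Sum>k<n. g (i + k)) + (\<Sum>k<m - n. g (i + (n + k)))"
      using sum_lessThan_split[of "\<lambda>k. g (i + k)" n "m - n"] n False by simp
    also have "\<dots> \<le> \<epsilon> * real n + (\<epsilon> * real (m - n) + real L)"
      using n less.IH[of "m - n" "i + n"] False by (intro add_mono) (auto simp: add.assoc)
    also have "\<dots> = \<epsilon> * real m + real L" using n False by (simp add: of_nat_diff algebra_simps)
    finally show ?thesis .
  qed
qed

lemma card_return_set_eq_sum:
  "real (card (return_set S x A \<inter> {..<n})) = (\<Sum>k<n. indicator A ((S ^^ k) x))"
proof -
  have "(\<Sum>k<n. indicator A ((S ^^ k) x)) = (\<Sum>k<n. indicator (return_set S x A) k :: real)"
    by (intro sum.cong) (auto simp: return_set_def indicator_def)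
  also have "\<dots> = real (card ({..<n} \<inter> return_set S x A))"
    by (simp add: indicator_def sum.If_cases Int_def)
  finally show ?thesis by (simp add: Int_commute)
qed

context finite_measure
begin

text \<open>A maximal inequality. Let \<open>G L\<close> be the part of \<open>Z\<close> where a rate of returns of at most \<open>\<epsilon>\<close>
  shows up by time \<open>L + 1\<close>. From any point of an orbit there is a block of bounded length on which
  \<open>G L\<close> is visited with rate at most \<open>\<epsilon>\<close>: a point outside \<open>G L\<close> is such a block by itself. Hence
  orbits visit \<open>G L\<close> with asymptotic rate at most \<open>\<epsilon>\<close>, and integrating over the invariant measure
  bounds the measure of \<open>G L\<close>.\<close>
lemma measure_rare_returns_le:
  assumes S[measurable]: "S \<in> measurable M M" and inv: "distr M M S = M"
    and A[measurable]: "A \<in> sets M" and "\<epsilon> > 0"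
  defines "Z \<equiv> {x \<in> A. \<exists>n\<ge>1. real (card (return_set S x A \<inter> {..<n})) \<le> \<epsilon> * real n}"
  shows "Z \<in> sets M" and "measure M Z \<le> \<epsilon> * measure M (space M)"
proof -
  have Sk[measurable]: "(S ^^ k) \<in> measurable M M" for k
    by (rule measurable_compose_n[OF S])
  define G where "G L = {x \<in> A. \<exists>n\<in>{1..Suc L}. (\<Sum>k<n. indicator A ((S ^^ k) x)) \<le> \<epsilon> * real n}" for L
  have G_alt: "G L = {x \<in> space M. x \<in> A \<and> (\<exists>n\<in>{1..Suc L}. (\<Sum>k<n. indicator A ((S ^^ k) x)) \<le> \<epsilon> * real n)}" for L
    using sets.sets_into_space[OF A] by (auto simp: G_def)
  have G[measurable]: "G L \<in> sets M" for L
    unfolding G_alt by measurable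
  have Z: "Z = (\<Union>L. G L)"
    unfolding Z_def G_def card_return_set_eq_sum
    by (auto intro: le_SucI) (metis One_nat_def atLeastAtMost_iff le_SucI order_refl)
  show "Z \<in> sets M" unfolding Z by measurable
  have distr_k: "distr M M (S ^^ k) = M" for k
  proof (induction k)
    case (Suc k)
    have "distr M M (S ^^ Suc k) = distr (distr M M (S ^^ k)) M S"
      by (subst distr_distr) (simp_all add: comp_def)
    then show ?case by (simp only: Suc inv)
  qed (simp add: id_def)
  have "measure M (G L) \<le> \<epsilon> * measure M (space M)" for L
  proof (rule ccontr)
    \<comment> \<open>The bounded error \<open>Suc L\<close> of the block decomposition is negligible over \<open>m\<close> steps, for \<open>m\<close>
      large.\<close>
    assume "\<not> ?thesis"
    then have "measure M (G L) - \<epsilon> * measure M (space M) > 0" by simp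
    then obtain m where m: "real (Suc L) * measure M (space M)
        < real m * (measure M (G L) - \<epsilon> * measure M (space M))"
      using reals_Archimedean3[of "measure M (G L) - \<epsilon> * measure M (space M)"] by blast
    have ptw: "(\<Sum>k<m. indicator (G L) ((S ^^ k) x)) \<le> \<epsilon> * real m + real (Suc L)" for x
    proof -
      have block: "\<exists>n. 1 \<le> n \<and> n \<le> Suc L \<and>
          (\<Sum>k<n. indicator (G L) ((S ^^ (i + k)) x)) \<le> \<epsilon> * real n" for i
      proof (cases "(S ^^ i) x \<in> G L")
        case True
        then obtain n where n: "n \<in> {1..Suc L}"
          "(\<Sum>k<n. indicator A ((S ^^ k) ((S ^^ i) x))) \<le> \<epsilon> * real n"
          by (auto simp: G_def)
        have "(\<Sum>k<n. indicator (G L) ((S ^^ (i + k)) x)) \<le> (\<Sum>k<n. indicator A ((S ^^ k) ((S ^^ i) x)) :: real)"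
          by (intro sum_mono) (auto simp: indicator_def G_def add.commute[of i] funpow_add)
        then show ?thesis using n by (intro exI[of _ n]) auto
      next
        case False
        then show ?thesis using \<open>\<epsilon> > 0\<close> by (intro exI[of _ 1]) auto
      qed
      have "(\<Sum>k<m. indicator (G L) ((S ^^ (0 + k)) x)) \<le> \<epsilon> * real m + real (Suc L)"
        by (rule sum_le_of_good_blocks[where g = "\<lambda>i. indicator (G L) ((S ^^ i) x)"])
          (use block \<open>\<epsilon> > 0\<close> in \<open>auto simp: indicator_def simp del: of_nat_Suc\<close>)
      then show ?thesis by (simp only: add_0)
    qed
    have int: "integrable M (\<lambda>x. indicator (G L) ((S ^^ k) x) :: real)" for k
      by (rule integrable_const_bound[of _ 1]) (auto simp: indicator_def, measurable)
    have "real m * measure M (G L) = (\<Sum>k<m. \<integral>x. indicator (G L) x \<partial>distr M M (S ^^ k))"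
      by (simp add: distr_k)
    also have "\<dots> = (\<Sum>k<m. \<integral>x. indicator (G L) ((S ^^ k) x) \<partial>M)"
      by (intro sum.cong refl integral_distr) auto
    also have "\<dots> = (\<integral>x. (\<Sum>k<m. indicator (G L) ((S ^^ k) x)) \<partial>M)"
      by (rule Bochner_Integration.integral_sum[symmetric]) (rule int)
    also have "\<dots> \<le> (\<integral>x. \<epsilon> * real m + real (Suc L) \<partial>M)"
      by (intro integral_mono Bochner_Integration.integrable_sum int ptw) auto
    also have "\<dots> = (\<epsilon> * real m + real (Suc L)) * measure M (space M)" by simp
    finally show False using m by (simp add: algebra_simps)
  qed
  moreover have "(\<lambda>L. measure M (G L)) \<longlonglongrightarrow> measure M (\<Union>L. G L)"
  proof (rule finite_Lim_measure_incseq)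
    show "range G \<subseteq> sets M" using G by blast
    show "incseq G" unfolding incseq_def G_def by fastforce
  qed
  ultimately show "measure M Z \<le> \<epsilon> * measure M (space M)"
    unfolding Z by (intro LIMSEQ_le_const2) auto
qed

lemma AE_lower_dens_return_set_pos:
  assumes S: "S \<in> measurable M M" and inv: "distr M M S = M" and A: "A \<in> sets M"
  shows "AE x in M. x \<in> A \<longrightarrow> lower_dens (return_set S x A) > 0"
proof -
  define Z where "Z j = {x \<in> A. \<exists>n\<ge>1. real (card (return_set S x A \<inter> {..<n})) \<le> inverse (real (Suc j)) * real n}" for j
  have Zm: "Z j \<in> sets M" for j
    unfolding Z_def by (rule measure_rare_returns_le(1)[OF S inv A]) simp
  have Zle: "measure M (Z j) \<le> inverse (real (Suc j)) * measure M (space M)" for j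
    unfolding Z_def by (rule measure_rare_returns_le(2)[OF S inv A]) simp
  have "measure M (\<Inter>j. Z j) \<le> 0"
  proof (rule LIMSEQ_le_const)
    show "(\<lambda>j. inverse (real (Suc j)) * measure M (space M)) \<longlonglongrightarrow> 0"
      by (rule tendsto_mult_left_zero[OF LIMSEQ_inverse_real_of_nat])
    have "measure M (\<Inter>j. Z j) \<le> inverse (real (Suc j)) * measure M (space M)" for j
      by (rule order_trans[OF finite_measure_mono Zle]) (auto simp: Zm)
    then show "\<exists>N. \<forall>n\<ge>N. measure M (\<Inter>j. Z j) \<le> inverse (real (Suc n)) * measure M (space M)" by blast
  qed
  then have "(\<Inter>j. Z j) \<in> null_sets M"
    using Zm by (simp add: null_sets_def emeasure_eq_measure measure_le_0_iff)
  then have "AE x in M. x \<notin> (\<Inter>j. Z j)" by (rule AE_not_in)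
  then show ?thesis
  proof eventually_elim
    case (elim x)
    show ?case
    proof
      assume "x \<in> A"
      obtain j where "x \<notin> Z j" using elim by blast
      with \<open>x \<in> A\<close> have j: "inverse (real (Suc j)) * real n < real (card (return_set S x A \<inter> {..<n}))"
        if "n \<ge> 1" for n
        using that unfolding Z_def mem_Collect_eq not_le[symmetric] by blast
      have "ereal (inverse (real (Suc j))) \<le> lower_dens (return_set S x A)"
        unfolding lower_dens_def
      proof (intro Liminf_bounded always_eventually allI)
        fix N :: nat
        have "{0..N} = {..<N + 1}" by auto
        then show "ereal (inverse (real (Suc j))) \<le> ereal (real (card (return_set S x A \<inter> {0..N})) / real (N + 1))"
          using j[of "N + 1"] by (simp add: field_simps)
      qed
      then show "lower_dens (return_set S x A) > 0"
        by (rule less_le_trans[rotated]) simp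
    qed
  qed
qed

end

section \<open>Invariant measures from weak-star limits of an orbit\<close>

text \<open>The weak-star topology enters only through a \<open>T\<close>-invariant norming family \<open>E\<close> of functionals
  such that a sequence in \<open>X\<close> that is bounded along an ultrafilter of times has a limit in \<open>X\<close>
  along it. The
  values of the functionals lie in an arbitrary normed space, so that both scalar fields are
  covered. The space \<open>X\<close> is a subset of a type because a dual space over \<open>'k\<close> is one.\<close>
locale compact_functional_system =
  fixes X :: "'a::banach set" and T :: "'a \<Rightarrow> 'a" and E :: "('a \<Rightarrow> 'b::real_normed_vector) set"
  assumes closed_X: "closed X" and subspace_X: "subspace X"
    and bounded_linear_T: "bounded_linear T" and T_in_X: "\<And>x. x \<in> X \<Longrightarrow> T x \<in> X"
    and separable_X: "separable_space (top_of_set X)"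
    and linear_E: "\<And>e. e \<in> E \<Longrightarrow> linear e"
    and E_comp_T: "\<And>e. e \<in> E \<Longrightarrow> (\<lambda>x. e (T x)) \<in> E"
    and norming: "\<And>x r. x \<in> X \<Longrightarrow> r < norm x \<Longrightarrow>
      \<exists>e\<in>E. (\<forall>y\<in>X. norm (e y) \<le> norm y) \<and> r < norm (e x)"
    and E_limit_exists: "\<And>(p :: nat filter) x R. ultrafilter p \<Longrightarrow> (\<And>k. x k \<in> X) \<Longrightarrow>
      eventually (\<lambda>k. norm (x k) \<le> R) p \<Longrightarrow> \<exists>l\<in>X. \<forall>e\<in>E. ((\<lambda>k. e (x k)) \<longlongrightarrow> e l) p"
begin

lemma funpow_T_in_X: "x \<in> X \<Longrightarrow> (T ^^ k) x \<in> X"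
  by (induction k) (auto simp: T_in_X)

text \<open>Balls are closed under \<open>E\<close>-limits, because the norm is a supremum of values of functionals
  in \<open>E\<close>.\<close>
lemma E_limit_norm_le:
  assumes p: "ultrafilter p" and x: "\<And>k. x k \<in> X" and l: "l \<in> X" and c: "c \<in> X"
    and lim: "\<And>e. e \<in> E \<Longrightarrow> ((\<lambda>k. e (x k)) \<longlongrightarrow> e l) p"
    and le: "eventually (\<lambda>k. norm (x k - c) \<le> r) p"
  shows "norm (l - c) \<le> r"
proof (rule ccontr)
  assume "\<not> norm (l - c) \<le> r"
  then obtain e where e: "e \<in> E" "\<And>y. y \<in> X \<Longrightarrow> norm (e y) \<le> norm y" "r < norm (e (l - c))"
    using norming[of "l - c" r] subspace_diff[OF subspace_X l c] by auto
  have diff: "e (y - c) = e y - e c" for y by (rule linear_diff[OF linear_E[OF e(1)]])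
  have "eventually (\<lambda>k. norm (e (x k) - e c) \<le> r) p"
    using le
  proof eventually_elim
    case (elim k)
    then show ?case
      using e(2)[OF subspace_diff[OF subspace_X x c], of k] by (simp add: diff)
  qed
  moreover have "((\<lambda>k. norm (e (x k) - e c)) \<longlongrightarrow> norm (e l - e c)) p"
    by (intro tendsto_intros lim e)
  ultimately have "norm (e l - e c) \<le> r"
    using p by (intro tendsto_upperbound) (auto simp: ultrafilter_def)
  then show False using e(3) by (simp add: diff)
qed

lemma E_limit_unique:
  assumes "ultrafilter p" "l \<in> X" "l' \<in> X"
    and "\<And>e. e \<in> E \<Longrightarrow> ((\<lambda>k. e (x k)) \<longlongrightarrow> e l) p" "\<And>e. e \<in> E \<Longrightarrow> ((\<lambda>k. e (x k)) \<longlongrightarrow> e l') p"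
  shows "l = l'"
proof (rule ccontr)
  assume "l \<noteq> l'"
  then obtain e where e: "e \<in> E" "0 < norm (e (l - l'))"
    using norming[of "l - l'" 0] subspace_diff[OF subspace_X assms(2,3)] by auto
  have "e l = e l'"
    using assms(1) assms(4,5)[OF e(1)] by (intro tendsto_unique) (auto simp: ultrafilter_def)
  then show False using e linear_diff[OF linear_E[OF e(1)]] by simp
qed

lemma countable_dense_subset:
  obtains D where "countable D" "D \<subseteq> X" "\<And>x \<epsilon>. x \<in> X \<Longrightarrow> \<epsilon> > 0 \<Longrightarrow> \<exists>d\<in>D. dist d x < \<epsilon>"
proof -
  obtain D where D: "countable D" "D \<subseteq> X" "top_of_set X closure_of D = X"
    using separable_X by (auto simp: separable_space_def)
  have "\<exists>d\<in>D. dist d x < \<epsilon>" if "x \<in> X" "\<epsilon> > 0" for x \<epsilon>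
  proof -
    have "x \<in> top_of_set X closure_of D" using D that by simp
    moreover have "openin (top_of_set X) (X \<inter> ball x \<epsilon>)" by (intro openin_open_Int) auto
    moreover have "x \<in> X \<inter> ball x \<epsilon>" using that by simp
    ultimately obtain y where "y \<in> D" "y \<in> X \<inter> ball x \<epsilon>"
      unfolding in_closure_of by blast
    then show ?thesis by (auto simp: dist_commute)
  qed
  then show thesis using that D by blast
qed

text \<open>Separability reduces the norming family to a sequence: it suffices to almost norm the points
  of a countable dense set. This makes balls countable intersections of conditions on single
  functionals, and hence measurable under \<open>E\<close>-limits.\<close>
lemma countable_norming:
  obtains e :: "nat \<Rightarrow> 'a \<Rightarrow> 'b" where "\<And>n. e n \<in> E"
    and "\<And>x r. x \<in> X \<Longrightarrow> norm x \<le> r \<longleftrightarrow> (\<forall>n. norm (e n x) \<le> r)"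
proof -
  obtain D where D: "countable D" "D \<subseteq> X" "\<And>x \<epsilon>. x \<in> X \<Longrightarrow> \<epsilon> > 0 \<Longrightarrow> \<exists>d\<in>D. dist d x < \<epsilon>"
    by (rule countable_dense_subset) blast
  have "0 \<in> X" using subspace_X by (rule subspace_0)
  then have "D \<noteq> {}" using D(3)[of 0 1] by auto
  define d where "d i = from_nat_into D i" for i
  have dX: "d i \<in> X" for i using from_nat_into[OF \<open>D \<noteq> {}\<close>] D(2) by (auto simp: d_def)
  have "\<forall>i m. \<exists>e\<in>E. (\<forall>y\<in>X. norm (e y) \<le> norm y) \<and> norm (d i) - inverse (real (Suc m)) < norm (e (d i))"
    using norming[OF dX] by simp
  then obtain f where f: "\<And>i m. f i m \<in> E" "\<And>i m y. y \<in> X \<Longrightarrow> norm (f i m y) \<le> norm y"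
    "\<And>i m. norm (d i) - inverse (real (Suc m)) < norm (f i m (d i))"
    by metis
  define e where "e n = f (fst (prod_decode n)) (snd (prod_decode n))" for n
  have f_e: "f i m = e (prod_encode (i, m))" for i m by (simp add: e_def)
  show thesis
  proof (rule that)
    show "e n \<in> E" for n by (simp add: e_def f)
  next
    fix x r assume x: "x \<in> X"
    show "norm x \<le> r \<longleftrightarrow> (\<forall>n. norm (e n x) \<le> r)"
    proof
      assume "norm x \<le> r"
      then show "\<forall>n. norm (e n x) \<le> r" unfolding e_def by (blast intro: order_trans[OF f(2)[OF x]])
    next
      assume le: "\<forall>n. norm (e n x) \<le> r"
      show "norm x \<le> r"
      proof (rule field_le_epsilon)
        fix \<epsilon> :: real assume "\<epsilon> > 0"
        then obtain m where m: "inverse (real (Suc m)) < \<epsilon> / 3"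
          using reals_Archimedean[of "\<epsilon> / 3"] by auto
        obtain y where "y \<in> D" "dist y x < \<epsilon> / 3" using D(3)[OF x, of "\<epsilon> / 3"] \<open>\<epsilon> > 0\<close> by auto
        moreover from this obtain i where "d i = y"
          using from_nat_into_surj[OF D(1)] unfolding d_def by blast
        ultimately have i: "norm (d i - x) < \<epsilon> / 3" by (simp add: dist_norm)
        have "norm (f i m (d i)) \<le> norm (f i m x) + norm (f i m (d i) - f i m x)"
          by (rule norm_triangle_sub)
        also have "f i m (d i) - f i m x = f i m (d i - x)"
          by (rule linear_diff[OF linear_E[OF f(1)], symmetric])
        also have "norm (f i m (d i - x)) \<le> norm (d i - x)"
          by (rule f(2)) (rule subspace_diff[OF subspace_X dX x])
        finally have "norm (f i m (d i)) \<le> r + \<epsilon> / 3"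
          using le[rule_format, of "prod_encode (i, m)"] i unfolding f_e by linarith
        moreover have "norm x \<le> norm (d i) + norm (d i - x)"
          using norm_triangle_sub[of x "d i"] by (simp add: norm_minus_commute)
        ultimately show "norm x \<le> r + \<epsilon>" using f(3)[of i m] m i by linarith
      qed
    qed
  qed
qed

text \<open>By separability this is the Borel sigma-algebra of \<open>X\<close>. Generating it by closed balls suits
  maps into \<open>X\<close> that are only weak-star continuous.\<close>
definition ball_algebra :: "'a measure" where
  "ball_algebra = sigma X {X \<inter> cball c r | c r. c \<in> X}"

lemma space_ball_algebra[simp]: "space ball_algebra = X"
  unfolding ball_algebra_def by (rule space_measure_of) auto

lemma cball_in_ball_algebra: "c \<in> X \<Longrightarrow> X \<inter> cball c r \<in> sets ball_algebra"
  unfolding ball_algebra_def by (subst sets_measure_of) auto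

lemma openin_in_ball_algebra:
  assumes "openin (top_of_set X) U"
  shows "U \<in> sets ball_algebra"
proof -
  obtain D where D: "countable D" "D \<subseteq> X" "\<And>x \<epsilon>. x \<in> X \<Longrightarrow> \<epsilon> > 0 \<Longrightarrow> \<exists>d\<in>D. dist d x < \<epsilon>"
    by (rule countable_dense_subset) blast
  define I where "I = {(d, n :: nat). d \<in> D \<and> X \<inter> cball d (inverse (real (Suc n))) \<subseteq> U}"
  have "countable I"
    by (rule countable_subset[of _ "D \<times> UNIV"]) (auto simp: I_def D(1))
  have "U = (\<Union>(d, n)\<in>I. X \<inter> cball d (inverse (real (Suc n))))" (is "_ = ?V")
  proof
    show "U \<subseteq> ?V"
    proof
      fix x assume "x \<in> U"
      with assms obtain \<epsilon> where \<epsilon>: "x \<in> X" "\<epsilon> > 0" "X \<inter> ball x \<epsilon> \<subseteq> U"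
        by (metis Int_commute openin_contains_ball subsetD)
      then obtain n where n: "inverse (real (Suc n)) < \<epsilon> / 2"
        using reals_Archimedean[of "\<epsilon> / 2"] by auto
      obtain d where d: "d \<in> D" "dist d x < inverse (real (Suc n))"
        using D(3)[OF \<epsilon>(1), of "inverse (real (Suc n))"] by auto
      have "X \<inter> cball d (inverse (real (Suc n))) \<subseteq> X \<inter> ball x \<epsilon>"
      proof
        fix y assume y: "y \<in> X \<inter> cball d (inverse (real (Suc n)))"
        then have "dist x y < \<epsilon>"
          using d(2) n dist_triangle[of x y d] by (simp add: dist_commute)
        then show "y \<in> X \<inter> ball x \<epsilon>" using y by simp
      qed
      then have "(d, n) \<in> I" using d(1) \<epsilon>(3) by (auto simp: I_def)
      then show "x \<in> ?V" using d(2) \<epsilon>(1) by (auto intro!: bexI[of _ "(d, n)"])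
    qed
  qed (auto simp: I_def)
  moreover have "?V \<in> sets ball_algebra"
    using \<open>countable I\<close> D(2) by (intro sets.countable_UN') (auto simp: I_def intro!: cball_in_ball_algebra)
  ultimately show ?thesis by simp
qed

lemma measurable_T: "T \<in> measurable ball_algebra ball_algebra"
  unfolding ball_algebra_def[of]
proof (rule measurable_measure_of)
  show "T \<in> space (sigma X {X \<inter> cball c r |c r. c \<in> X}) \<rightarrow> X"
    using T_in_X space_ball_algebra unfolding ball_algebra_def by auto
  fix B assume "B \<in> {X \<inter> cball c r |c r. c \<in> X}"
  then obtain c r where B: "B = X \<inter> cball c r" "c \<in> X" by blast
  have "continuous_on UNIV T" using bounded_linear_T by (rule linear_continuous_on)
  then have "open (T -` (- cball c r))" by (intro open_vimage) auto
  then have "openin (top_of_set X) (X \<inter> T -` (- cball c r))" by (rule openin_open_Int)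
  then have "X - (X \<inter> T -` (- cball c r)) \<in> sets ball_algebra"
    using openin_in_ball_algebra sets.compl_sets[of _ ball_algebra] by simp
  also have "X - (X \<inter> T -` (- cball c r)) = T -` B \<inter> X"
    using T_in_X by (auto simp: B)
  finally show "T -` B \<inter> space (sigma X {X \<inter> cball c r |c r. c \<in> X})
      \<in> sets (sigma X {X \<inter> cball c r |c r. c \<in> X})"
    using space_ball_algebra unfolding ball_algebra_def by simp
qed auto

text \<open>The measure is the image of the Stone measure of an invariant mean under \<open>st\<close>, the \<open>E\<close>-limit
  of the orbit of \<open>z\<close> along an ultrafilter. This limit is available on the set \<open>\<Omega>\<close> of ultrafilters
  along which the orbit is bounded, and \<open>st\<close> intertwines the shift with \<open>T\<close>. The shift maps \<open>\<Omega>\<close>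
  into itself, which gives only \<open>M (T -` B) \<le> M B\<close>; applying this to the complement as well turns
  it into an equality, as \<open>M\<close> is finite.\<close>
lemma invariant_measure_exists:
  assumes z: "z \<in> X" and c: "c \<in> X"
    and dens: "upper_Banach_dens (return_set T z (X \<inter> cball c r)) > 0"
  obtains M where "finite_measure M" "sets M = sets ball_algebra" "distr M M T = M"
    "emeasure M (X \<inter> cball c r) > 0"
proof -
  define zk where "zk k = (T ^^ k) z" for k
  have zk: "zk k \<in> X" for k unfolding zk_def by (rule funpow_T_in_X[OF z])
  define A where "A = return_set T z (X \<inter> cball c r)"
  have A: "A = {k. norm (zk k - c) \<le> r}"
    using zk by (auto simp: A_def return_set_def zk_def dist_norm norm_minus_commute)
  obtain d :: "nat set \<Rightarrow> real" where d: "\<And>E. 0 \<le> d E"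
    "\<And>E F. E \<inter> F = {} \<Longrightarrow> d (E \<union> F) = d E + d F" "\<And>E. d (Suc -` E) = d E" "d A > 0"
    using invariant_mean_exists[OF dens] unfolding A_def by blast
  obtain P where spP: "space P = ultrafilters_on UNIV"
    and stP: "sets P = sigma_sets (ultrafilters_on UNIV) (range ultrafilters_on)"
    and emP: "\<And>E. emeasure P (ultrafilters_on E) = ennreal (d E)"
    using stone_measure_exists[of d] d by blast
  have hat[measurable]: "ultrafilters_on E \<in> sets P" for E by (auto simp: stP)
  note shift[measurable] = filtermap_Suc_preserves_stone_measure(1)[OF spP stP emP d(3)]
  note shift_inv = filtermap_Suc_preserves_stone_measure(2)[OF spP stP emP d(3)]
  interpret P: finite_measure P by standard (simp add: spP emP)
  define \<Omega> where "\<Omega> = (\<Union>R::nat. ultrafilters_on {k. norm (zk k) \<le> real R})"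
  have \<Omega>[measurable]: "\<Omega> \<in> sets P" unfolding \<Omega>_def by measurable
  have \<Omega>I: "p \<in> \<Omega>" if "ultrafilter p" "eventually (\<lambda>k. norm (zk k) \<le> R) p" for p R
  proof -
    obtain n :: nat where "R \<le> real n" using real_arch_simple by blast
    then have "eventually (\<lambda>k. norm (zk k) \<le> real n) p"
      using that(2) by (auto elim: eventually_mono)
    then show ?thesis using that(1) by (auto simp: \<Omega>_def ultrafilters_on_def)
  qed
  have \<Omega>D: "ultrafilter p" if "p \<in> \<Omega>" for p
    using that by (auto simp: \<Omega>_def ultrafilters_on_def)
  define st where "st p = (SOME l. l \<in> X \<and> (\<forall>e\<in>E. ((\<lambda>k. e (zk k)) \<longlongrightarrow> e l) p))" for p
  have st: "st p \<in> X" "\<And>e. e \<in> E \<Longrightarrow> ((\<lambda>k. e (zk k)) \<longlongrightarrow> e (st p)) p" if "p \<in> \<Omega>" for p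
  proof -
    obtain R where "eventually (\<lambda>k. norm (zk k) \<le> real R) p"
      using \<open>p \<in> \<Omega>\<close> by (auto simp: \<Omega>_def ultrafilters_on_def)
    then have "\<exists>l\<in>X. \<forall>e\<in>E. ((\<lambda>k. e (zk k)) \<longlongrightarrow> e l) p"
      by (rule E_limit_exists[OF \<Omega>D[OF \<open>p \<in> \<Omega>\<close>] zk])
    then have "\<exists>l. l \<in> X \<and> (\<forall>e\<in>E. ((\<lambda>k. e (zk k)) \<longlongrightarrow> e l) p)" by blast
    from someI_ex[OF this] show "st p \<in> X" "\<And>e. e \<in> E \<Longrightarrow> ((\<lambda>k. e (zk k)) \<longlongrightarrow> e (st p)) p"
      unfolding st_def by blast+
  qed
  have st_shift: "filtermap Suc p \<in> \<Omega>" "st (filtermap Suc p) = T (st p)" if p: "p \<in> \<Omega>" for p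
  proof -
    obtain R where R: "eventually (\<lambda>k. norm (zk k) \<le> real R) p"
      using p by (auto simp: \<Omega>_def ultrafilters_on_def)
    obtain K where K: "K > 0" "\<And>x. norm (T x) \<le> norm x * K"
      using bounded_linear.pos_bounded[OF bounded_linear_T] by blast
    have "eventually (\<lambda>k. norm (zk (Suc k)) \<le> real R * K) p"
      using R
    proof eventually_elim
      case (elim k)
      have "norm (zk (Suc k)) \<le> norm (zk k) * K" using K(2) by (simp add: zk_def)
      also have "\<dots> \<le> real R * K" using elim K(1) by simp
      finally show ?case .
    qed
    then show in\<Omega>: "filtermap Suc p \<in> \<Omega>"
      by (intro \<Omega>I[of _ "real R * K"] ultrafilter_filtermap \<Omega>D[OF p]) (simp add: eventually_filtermap)
    have "((\<lambda>k. e (zk k)) \<longlongrightarrow> e (T (st p))) (filtermap Suc p)" if "e \<in> E" for e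
      using st(2)[OF p E_comp_T[OF that]] by (simp add: filterlim_filtermap zk_def)
    then show "st (filtermap Suc p) = T (st p)"
      using st[OF in\<Omega>] st(1)[OF p] T_in_X \<Omega>D[OF in\<Omega>] by (intro E_limit_unique[where x = zk]) auto
  qed
  define Q where "Q = restrict_space P \<Omega>"
  have spQ: "space Q = \<Omega>"
    using sets.sets_into_space[OF \<Omega>] by (auto simp: Q_def space_restrict_space)
  have emQ: "emeasure Q B = emeasure P B" if "B \<subseteq> \<Omega>" for B
    unfolding Q_def by (rule emeasure_restrict_space) (use that \<Omega> in auto)
  have setsQ: "B \<in> sets Q \<longleftrightarrow> B \<in> sets P \<and> B \<subseteq> \<Omega>" for B
    unfolding Q_def by (subst sets_restrict_space_iff) (use \<Omega> in auto)
  interpret Q: finite_measure Q by standard (simp add: spQ emQ)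
  obtain e :: "nat \<Rightarrow> 'a \<Rightarrow> 'b" where e: "\<And>n. e n \<in> E"
    "\<And>x r. x \<in> X \<Longrightarrow> norm x \<le> r \<longleftrightarrow> (\<forall>n. norm (e n x) \<le> r)"
    by (rule countable_norming) blast
  have stQ: "st \<in> measurable Q ball_algebra"
    unfolding ball_algebra_def
  proof (rule measurable_measure_of)
    show "st \<in> space Q \<rightarrow> X" using st(1) by (auto simp: spQ)
    fix B assume "B \<in> {X \<inter> cball c r |c r. c \<in> X}"
    then obtain a s where B: "B = X \<inter> cball a s" and a: "a \<in> X" by blast
    \<comment> \<open>The slack \<open>inverse (Suc m)\<close> turns the inequality for the limit into strict inequalities along
      the ultrafilter.\<close>
    have "p \<in> \<Omega> \<and> st p \<in> B \<longleftrightarrow>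
        p \<in> \<Omega> \<inter> (\<Inter>n m. ultrafilters_on {k. norm (e n (zk k) - e n a) < s + inverse (real (Suc m))})"
      (is "_ \<longleftrightarrow> p \<in> ?R") for p
    proof (cases "p \<in> \<Omega>")
      case True
      note p = \<Omega>D[OF True]
      have lim: "((\<lambda>k. norm (e n (zk k) - e n a)) \<longlongrightarrow> norm (e n (st p) - e n a)) p" for n
        by (intro tendsto_intros st(2)[OF True] e)
      have "st p \<in> B \<longleftrightarrow> norm (st p - a) \<le> s"
        using st(1)[OF True] by (simp add: B dist_norm norm_minus_commute)
      also have "\<dots> \<longleftrightarrow> (\<forall>n. norm (e n (st p) - e n a) \<le> s)"
        using e(2)[OF subspace_diff[OF subspace_X st(1)[OF True] a]]
        by (simp add: linear_diff[OF linear_E[OF e(1)]])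
      also have "\<dots> \<longleftrightarrow> (\<forall>n m. eventually (\<lambda>k. norm (e n (zk k) - e n a) < s + inverse (real (Suc m))) p)"
      proof (intro all_cong1 iffI allI)
        fix n m assume "norm (e n (st p) - e n a) \<le> s"
        moreover have "0 < inverse (real (Suc m))" by simp
        ultimately have "norm (e n (st p) - e n a) < s + inverse (real (Suc m))" by linarith
        then show "eventually (\<lambda>k. norm (e n (zk k) - e n a) < s + inverse (real (Suc m))) p"
          by (rule order_tendstoD(2)[OF lim])
      next
        fix n assume ev: "\<forall>m. eventually (\<lambda>k. norm (e n (zk k) - e n a) < s + inverse (real (Suc m))) p"
        have le: "norm (e n (st p) - e n a) \<le> s + inverse (real (Suc m))" for m
        proof (rule tendsto_upperbound[OF lim])
          show "eventually (\<lambda>k. norm (e n (zk k) - e n a) \<le> s + inverse (real (Suc m))) p"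
            using ev[rule_format, of m] by (rule eventually_mono) (rule less_imp_le)
          show "p \<noteq> bot" using p by (simp add: ultrafilter_def)
        qed
        have "(\<lambda>m. s + inverse (real (Suc m))) \<longlonglongrightarrow> s + 0"
          by (intro tendsto_intros LIMSEQ_inverse_real_of_nat)
        then have "norm (e n (st p) - e n a) \<le> s + 0"
          by (rule LIMSEQ_le_const) (use le in blast)
        then show "norm (e n (st p) - e n a) \<le> s" by simp
      qed
      also have "\<dots> \<longleftrightarrow> p \<in> ?R" using p True by (simp add: ultrafilters_on_def)
      finally show ?thesis using True by simp
    qed simp
    then have "st -` B \<inter> space Q = ?R" unfolding spQ by blast
    moreover have "?R \<in> sets P" by measurable
    ultimately show "st -` B \<inter> space Q \<in> sets Q" by (simp add: setsQ)
  qed auto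
  define M where "M = distr Q ball_algebra st"
  have setsM: "sets M = sets ball_algebra" by (simp add: M_def)
  have spM: "space M = X" by (simp add: M_def)
  have emM: "emeasure M B = emeasure P {p \<in> \<Omega>. st p \<in> B}"
    and inP: "{p \<in> \<Omega>. st p \<in> B} \<in> sets P" if "B \<in> sets ball_algebra" for B
  proof -
    have eq: "st -` B \<inter> space Q = {p \<in> \<Omega>. st p \<in> B}" by (auto simp: spQ)
    have "emeasure M B = emeasure Q (st -` B \<inter> space Q)"
      unfolding M_def by (rule emeasure_distr[OF stQ that])
    then show "emeasure M B = emeasure P {p \<in> \<Omega>. st p \<in> B}"
      unfolding eq by (subst (asm) emQ) auto
    show "{p \<in> \<Omega>. st p \<in> B} \<in> sets P"
      using measurable_sets[OF stQ that] unfolding eq setsQ by blast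
  qed
  have finM: "finite_measure M" unfolding M_def by (rule Q.finite_measure_distr[OF stQ])
  interpret M: finite_measure M by (rule finM)
  have TM: "T \<in> measurable M M"
    using measurable_T measurable_cong_sets[OF setsM setsM] by blast
  have le: "emeasure M (T -` B \<inter> X) \<le> emeasure M B" if B: "B \<in> sets ball_algebra" for B
  proof -
    have "T -` B \<inter> X \<in> sets ball_algebra"
      using measurable_sets[OF measurable_T B] by simp
    then have "emeasure M (T -` B \<inter> X) = emeasure P {p \<in> \<Omega>. st p \<in> T -` B \<inter> X}" by (rule emM)
    also have "\<dots> \<le> emeasure P (filtermap Suc -` {p \<in> \<Omega>. st p \<in> B} \<inter> space P)"
      using st_shift sets.sets_into_space[OF \<Omega>] measurable_sets[OF shift inP[OF B]]
      by (intro emeasure_mono) auto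
    also have "\<dots> = emeasure (distr P P (filtermap Suc)) {p \<in> \<Omega>. st p \<in> B}"
      by (rule emeasure_distr[OF shift inP[OF B], symmetric])
    also have "\<dots> = emeasure M B" by (simp add: shift_inv emM[OF B])
    finally show ?thesis .
  qed
  have "distr M M T = M"
  proof (rule measure_eqI)
    fix B assume "B \<in> sets (distr M M T)"
    then have B: "B \<in> sets ball_algebra" "B \<in> sets M" by (simp_all add: setsM)
    have BX: "B \<subseteq> X" using sets.sets_into_space[OF B(2)] spM by simp
    have T_B: "T -` B \<inter> X \<in> sets M" using measurable_sets[OF TM B(2)] spM by simp
    have "measure M (T -` (X - B) \<inter> X) = measure M (X - (T -` B \<inter> X))"
      using T_in_X by (intro arg_cong[where f = "measure M"]) auto
    also have "\<dots> = measure M X - measure M (T -` B \<inter> X)"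
      using M.finite_measure_compl[OF T_B] by (simp add: spM)
    finally have 1: "measure M (T -` (X - B) \<inter> X) = measure M X - measure M (T -` B \<inter> X)" .
    have 2: "measure M (X - B) = measure M X - measure M B"
      using M.finite_measure_compl[OF B(2)] by (simp add: spM)
    have "X - B \<in> sets ball_algebra" using B(1) sets.compl_sets[of B ball_algebra] by simp
    from le[OF this] le[OF B(1)]
    have "measure M (T -` (X - B) \<inter> X) \<le> measure M (X - B)" "measure M (T -` B \<inter> X) \<le> measure M B"
      by (simp_all add: M.emeasure_eq_measure)
    then have "measure M (T -` B \<inter> X) = measure M B" using 1 2 by linarith
    then show "emeasure (distr M M T) B = emeasure M B"
      by (simp add: emeasure_distr[OF TM B(2)] spM M.emeasure_eq_measure)
  qed simp
  moreover have "emeasure M (X \<inter> cball c r) > 0"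
  proof -
    have sub: "ultrafilters_on A \<subseteq> {p \<in> \<Omega>. st p \<in> X \<inter> cball c r}"
    proof
      fix p assume "p \<in> ultrafilters_on A"
      then have p: "ultrafilter p" and ev: "eventually (\<lambda>k. norm (zk k - c) \<le> r) p"
        by (auto simp: ultrafilters_on_def A)
      have "eventually (\<lambda>k. norm (zk k) \<le> r + norm c) p"
        using ev
      proof eventually_elim
        case (elim k)
        then show ?case using norm_triangle_sub[of "zk k" c] by linarith
      qed
      then have in\<Omega>: "p \<in> \<Omega>" by (rule \<Omega>I[OF p])
      have "norm (st p - c) \<le> r"
        by (rule E_limit_norm_le[OF p zk st(1)[OF in\<Omega>] c st(2)[OF in\<Omega>] ev])
      then show "p \<in> {p \<in> \<Omega>. st p \<in> X \<inter> cball c r}"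
        using in\<Omega> st(1)[OF in\<Omega>] by (simp add: dist_norm norm_minus_commute)
    qed
    have "0 < emeasure P (ultrafilters_on A)" using d(4) by (simp add: emP)
    also have "\<dots> \<le> emeasure P {p \<in> \<Omega>. st p \<in> X \<inter> cball c r}"
      by (rule emeasure_mono[OF sub inP[OF cball_in_ball_algebra[OF c]]])
    also have "\<dots> = emeasure M (X \<inter> cball c r)"
      by (rule emM[OF cball_in_ball_algebra[OF c], symmetric])
    finally show ?thesis .
  qed
  ultimately show thesis using that finM setsM by blast
qed

end

section \<open>Product measures and frequent recurrence of the direct sums\<close>

lemma topspace_sum_topology_n: "topspace (sum_topology_n n (top_of_set X)) = (\<Pi>\<^sub>E i\<in>{..<n}. X)"
  by (simp add: sum_topology_n_def)

lemma openin_sum_topology_n_contains_box: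
  fixes X :: "'a::metric_space set"
  assumes U: "openin (sum_topology_n n (top_of_set X)) U" and u: "u \<in> U"
  obtains \<epsilon> where "\<epsilon> > 0"
    "\<And>v. v \<in> (\<Pi>\<^sub>E i\<in>{..<n}. X) \<Longrightarrow> (\<And>i. i < n \<Longrightarrow> dist (u i) (v i) < \<epsilon>) \<Longrightarrow> v \<in> U"
proof -
  obtain W where W: "\<And>i. i < n \<Longrightarrow> openin (top_of_set X) (W i)" "u \<in> (\<Pi>\<^sub>E i\<in>{..<n}. W i)"
    "(\<Pi>\<^sub>E i\<in>{..<n}. W i) \<subseteq> U"
  proof -
    have "\<forall>x\<in>U. \<exists>W. finite {i \<in> {..<n}. W i \<noteq> topspace (top_of_set X)} \<and>
        (\<forall>i\<in>{..<n}. openin (top_of_set X) (W i)) \<and> x \<in> Pi\<^sub>E {..<n} W \<and> Pi\<^sub>E {..<n} W \<subseteq> U"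
      using U unfolding sum_topology_n_def openin_product_topology_alt .
    then show thesis using u that by (meson lessThan_iff)
  qed
  have "\<exists>\<epsilon>>0. ball (u i) \<epsilon> \<inter> X \<subseteq> W i" if "i < n" for i
  proof -
    have "u i \<in> W i" using W(2) that by auto
    then show ?thesis using W(1)[OF that] unfolding openin_contains_ball by blast
  qed
  then obtain \<epsilon> where \<epsilon>: "\<And>i. i < n \<Longrightarrow> \<epsilon> i > 0 \<and> ball (u i) (\<epsilon> i) \<inter> X \<subseteq> W i" by metis
  \<comment> \<open>The extra element \<open>1\<close> covers \<open>n = 0\<close>.\<close>
  define \<delta> where "\<delta> = Min (insert (1::real) (\<epsilon> ` {..<n}))"
  have \<delta>: "\<delta> \<le> \<epsilon> i" if "i < n" for i unfolding \<delta>_def by (rule Min_le) (use that in auto)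
  show thesis
  proof (rule that)
    show "\<delta> > 0" unfolding \<delta>_def by (subst Min_gr_iff) (use \<epsilon> in auto)
    fix v assume v: "v \<in> (\<Pi>\<^sub>E i\<in>{..<n}. X)" "\<And>i. i < n \<Longrightarrow> dist (u i) (v i) < \<delta>"
    have "v i \<in> W i" if "i < n" for i
    proof -
      have "v i \<in> ball (u i) (\<epsilon> i) \<inter> X" using v \<delta>[OF that] that by (fastforce simp: PiE_mem)
      then show ?thesis using \<epsilon>[OF that] by blast
    qed
    then have "v \<in> (\<Pi>\<^sub>E i\<in>{..<n}. W i)" using v(1) by (auto simp: PiE_iff)
    then show "v \<in> U" using W(3) by blast
  qed
qed

lemma openin_box:
  fixes X :: "'a::metric_space set"
  shows "openin (sum_topology_n n (top_of_set X)) (\<Pi>\<^sub>E i\<in>{..<n}. X \<inter> ball (c i) \<epsilon>)"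
  unfolding sum_topology_n_def by (subst openin_PiE) (auto intro!: openin_open_Int)

lemma openin_sum_topology_n_box:
  assumes "\<And>i. i < n \<Longrightarrow> openin \<tau> (U i)"
  shows "openin (sum_topology_n n \<tau>) (\<Pi>\<^sub>E i\<in>{..<n}. U i)"
  unfolding sum_topology_n_def by (subst openin_PiE) (use assms in auto)

lemma dense_in_iff:
  "dense_in \<tau> A \<longleftrightarrow> A \<subseteq> topspace \<tau> \<and> (\<forall>U. openin \<tau> U \<and> U \<noteq> {} \<longrightarrow> A \<inter> U \<noteq> {})"
  unfolding dense_in_def dense_intersects_open by blast

lemma dense_in_top_of_set_approx:
  fixes X :: "'a::metric_space set"
  assumes "dense_in (top_of_set X) A" "x \<in> X" "\<epsilon> > 0"
  obtains a where "a \<in> A" "a \<in> X" "dist x a < \<epsilon>"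
proof -
  have "openin (top_of_set X) (X \<inter> ball x \<epsilon>)" by (intro openin_open_Int) auto
  moreover have "x \<in> X \<inter> ball x \<epsilon>" using assms by simp
  ultimately have "A \<inter> (X \<inter> ball x \<epsilon>) \<noteq> {}" using assms(1) unfolding dense_in_iff by blast
  then show thesis using that by auto
qed

lemma sum_operator_n_funpow:
  assumes "x \<in> (\<Pi>\<^sub>E i\<in>{..<n}. X)"
  shows "(sum_operator_n n T ^^ k) x = (\<lambda>i\<in>{..<n}. (T ^^ k) (x i))"
proof (induction k)
  case 0
  show ?case using assms by (auto simp: PiE_def extensional_def fun_eq_iff)
next
  case (Suc k)
  then show ?case by (simp add: sum_operator_n_def fun_eq_iff)
qed

lemma return_set_mono: "A \<subseteq> B \<Longrightarrow> return_set S x A \<subseteq> return_set S x B"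
  by (auto simp: return_set_def)

lemma return_set_sum_operator_n:
  assumes "x \<in> (\<Pi>\<^sub>E i\<in>{..<n}. X)"
  shows "return_set (sum_operator_n n T) x (\<Pi>\<^sub>E i\<in>{..<n}. A i) = {k. \<forall>i<n. (T ^^ k) (x i) \<in> A i}"
  by (auto simp: return_set_def sum_operator_n_funpow[OF assms])

lemma lower_dens_mono: "A \<subseteq> B \<Longrightarrow> lower_dens A \<le> lower_dens B"
  unfolding lower_dens_def
  by (intro Liminf_mono always_eventually allI)
    (auto intro!: divide_right_mono card_mono simp del: of_nat_Suc)

context compact_functional_system
begin

text \<open>The factors of the boxes are open in \<open>X\<close>, so that the boxes are also measurable for product
  measures.\<close>
lemma countable_box_base:
  obtains B where "countable B"
    and "\<And>b. b \<in> B \<Longrightarrow> openin (sum_topology_n n (top_of_set X)) b"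
    and "\<And>b. b \<in> B \<Longrightarrow> \<exists>f. b = (\<Pi>\<^sub>E i\<in>{..<n}. f i) \<and> (\<forall>i<n. openin (top_of_set X) (f i))"
    and "\<And>U u. openin (sum_topology_n n (top_of_set X)) U \<Longrightarrow> u \<in> U \<Longrightarrow> \<exists>b\<in>B. u \<in> b \<and> b \<subseteq> U"
proof -
  obtain D where D: "countable D" "D \<subseteq> X" "\<And>x \<epsilon>. x \<in> X \<Longrightarrow> \<epsilon> > 0 \<Longrightarrow> \<exists>d\<in>D. dist d x < \<epsilon>"
    by (rule countable_dense_subset) blast
  define C where "C = (\<lambda>(d, m :: nat). X \<inter> ball d (inverse (real (Suc m)))) ` (D \<times> UNIV)"
  have "countable C" unfolding C_def using D(1) by blast
  have C_open: "openin (top_of_set X) c" if "c \<in> C" for c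
    using that by (auto simp: C_def intro!: openin_open_Int)
  define B where "B = (\<lambda>f. \<Pi>\<^sub>E i\<in>{..<n}. f i) ` (\<Pi>\<^sub>E i\<in>{..<n}. C)"
  show thesis
  proof (rule that)
    show "countable B"
      unfolding B_def by (intro countable_image countable_PiE) (auto simp: \<open>countable C\<close>)
    show box: "\<exists>f. b = (\<Pi>\<^sub>E i\<in>{..<n}. f i) \<and> (\<forall>i<n. openin (top_of_set X) (f i))" if "b \<in> B" for b
    proof -
      obtain f where "f \<in> (\<Pi>\<^sub>E i\<in>{..<n}. C)" "b = (\<Pi>\<^sub>E i\<in>{..<n}. f i)"
        using \<open>b \<in> B\<close> unfolding B_def by blast
      then show ?thesis using C_open by (intro exI[of _ f]) (simp add: PiE_iff)
    qed
    show "openin (sum_topology_n n (top_of_set X)) b" if "b \<in> B" for b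
      using box[OF that] by (auto intro!: openin_sum_topology_n_box)
  next
    fix U u assume U: "openin (sum_topology_n n (top_of_set X)) U" and u: "u \<in> U"
    have uX: "u \<in> (\<Pi>\<^sub>E i\<in>{..<n}. X)"
      using openin_subset[OF U] u by (auto simp: topspace_sum_topology_n)
    obtain \<epsilon> where \<epsilon>: "\<epsilon> > 0"
      "\<And>v. v \<in> (\<Pi>\<^sub>E i\<in>{..<n}. X) \<Longrightarrow> (\<And>i. i < n \<Longrightarrow> dist (u i) (v i) < \<epsilon>) \<Longrightarrow> v \<in> U"
      using openin_sum_topology_n_contains_box[OF U u] by blast
    obtain m where m: "inverse (real (Suc m)) < \<epsilon> / 2"
      using reals_Archimedean[of "\<epsilon> / 2"] \<epsilon>(1) by auto
    have "\<exists>d\<in>D. dist d (u i) < inverse (real (Suc m))" if "i < n" for i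
      using D(3)[of "u i" "inverse (real (Suc m))"] uX that by auto
    then obtain d where d: "\<And>i. i < n \<Longrightarrow> d i \<in> D" "\<And>i. i < n \<Longrightarrow> dist (d i) (u i) < inverse (real (Suc m))"
      by metis
    define f where "f = (\<lambda>i\<in>{..<n}. X \<inter> ball (d i) (inverse (real (Suc m))))"
    have "f \<in> (\<Pi>\<^sub>E i\<in>{..<n}. C)" using d(1) by (auto simp: f_def C_def)
    then have "(\<Pi>\<^sub>E i\<in>{..<n}. f i) \<in> B" unfolding B_def by blast
    moreover have "u \<in> (\<Pi>\<^sub>E i\<in>{..<n}. f i)"
      using uX d(2) by (auto simp: f_def PiE_iff)
    moreover have "(\<Pi>\<^sub>E i\<in>{..<n}. f i) \<subseteq> U"
    proof
      fix v assume v: "v \<in> (\<Pi>\<^sub>E i\<in>{..<n}. f i)"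
      show "v \<in> U"
      proof (rule \<epsilon>(2))
        show "v \<in> (\<Pi>\<^sub>E i\<in>{..<n}. X)" using v by (auto simp: f_def PiE_iff)
        fix i assume i: "i < n"
        have "v i \<in> f i" using v i by auto
        then have "dist (d i) (v i) < inverse (real (Suc m))" using i by (simp add: f_def)
        then show "dist (u i) (v i) < \<epsilon>"
          using d(2)[OF i] m dist_triangle[of "u i" "v i" "d i"] by (simp add: dist_commute)
      qed
    qed
    ultimately show "\<exists>b\<in>B. u \<in> b \<and> b \<subseteq> U" by blast
  qed
qed

lemma sum_operator_n_preserves_product_measure:
  fixes M :: "nat \<Rightarrow> 'a measure"
  assumes fin: "\<And>i. finite_measure (M i)" and sets: "\<And>i. sets (M i) = sets ball_algebra"
    and inv: "\<And>i. i < n \<Longrightarrow> distr (M i) (M i) T = M i"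
  shows "sum_operator_n n T \<in> measurable (PiM {..<n} M) (PiM {..<n} M)"
    and "distr (PiM {..<n} M) (PiM {..<n} M) (sum_operator_n n T) = PiM {..<n} M"
    and "finite_measure (PiM {..<n} M)"
proof -
  interpret product_sigma_finite M
    unfolding product_sigma_finite_def using finite_measure.axioms(1)[OF fin] by blast
  have sp: "space (M i) = X" for i using sets_eq_imp_space_eq[OF sets[of i]] by simp
  have TM: "T \<in> measurable (M i) (M i)" for i
    using measurable_T measurable_cong_sets[OF sets[of i] sets[of i]] by blast
  show meas: "sum_operator_n n T \<in> measurable (PiM {..<n} M) (PiM {..<n} M)"
    unfolding sum_operator_n_def
    by (intro measurable_restrict measurable_compose[OF _ TM] measurable_component_singleton)
  show "distr (PiM {..<n} M) (PiM {..<n} M) (sum_operator_n n T) = PiM {..<n} M"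
  proof (rule PiM_eqI)
    fix A assume A: "\<And>i. i \<in> {..<n} \<Longrightarrow> A i \<in> sets (M i)"
    have pre: "sum_operator_n n T -` (\<Pi>\<^sub>E i\<in>{..<n}. A i) \<inter> space (PiM {..<n} M)
        = (\<Pi>\<^sub>E i\<in>{..<n}. T -` A i \<inter> space (M i))"
      by (auto simp: sum_operator_n_def space_PiM PiE_iff)
    have "emeasure (distr (PiM {..<n} M) (PiM {..<n} M) (sum_operator_n n T)) (\<Pi>\<^sub>E i\<in>{..<n}. A i)
        = emeasure (PiM {..<n} M) (\<Pi>\<^sub>E i\<in>{..<n}. T -` A i \<inter> space (M i))"
      unfolding pre[symmetric] by (rule emeasure_distr[OF meas]) (use A in \<open>auto intro!: sets_PiM_I_finite\<close>)
    also have "\<dots> = (\<Prod>i<n. emeasure (M i) (T -` A i \<inter> space (M i)))"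
      by (rule emeasure_PiM) (use A measurable_sets[OF TM] in auto)
    also have "\<dots> = (\<Prod>i<n. emeasure (M i) (A i))"
    proof (rule prod.cong)
      fix i assume i: "i \<in> {..<n}"
      then have "emeasure (M i) (A i) = emeasure (distr (M i) (M i) T) (A i)" using inv by simp
      also have "\<dots> = emeasure (M i) (T -` A i \<inter> space (M i))"
        by (rule emeasure_distr[OF TM A[OF i]])
      finally show "emeasure (M i) (T -` A i \<inter> space (M i)) = emeasure (M i) (A i)" ..
    qed simp
    finally show "emeasure (distr (PiM {..<n} M) (PiM {..<n} M) (sum_operator_n n T)) (\<Pi>\<^sub>E i\<in>{..<n}. A i)
      = (\<Prod>i<n. emeasure (M i) (A i))" .
  qed simp_all
  show "finite_measure (PiM {..<n} M)"
  proof
    have "emeasure (PiM {..<n} M) (space (PiM {..<n} M)) = (\<Prod>i<n. emeasure (M i) (space (M i)))"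
      unfolding space_PiM by (rule emeasure_PiM) auto
    also have "\<dots> \<noteq> \<infinity>"
      by (simp add: finite_measure.emeasure_eq_measure[OF fin] prod_ennreal)
    finally show "emeasure (PiM {..<n} M) (space (PiM {..<n} M)) \<noteq> \<infinity>" .
  qed
qed

text \<open>Around reiteratively recurrent vectors \<open>c i\<close> close to the coordinates of a given point sit
  balls charged by invariant measures. Their product charges the box of these balls, and almost
  every \<open>y\<close> returns with positive lower density to each member of a countable base that contains
  it.\<close>
lemma sum_operator_n_frequently_recurrent:
  assumes rr: "reiteratively_recurrent (top_of_set X) T"
  shows "frequently_recurrent (sum_topology_n n (top_of_set X)) (sum_operator_n n T)"
  unfolding frequently_recurrent_def dense_in_iff
proof (intro conjI allI impI)
  let ?\<tau> = "sum_topology_n n (top_of_set X)" and ?S = "sum_operator_n n T"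
  let ?R = "{x \<in> topspace ?\<tau>. \<forall>U. x \<in> ?\<tau> interior_of U \<longrightarrow> lower_dens (return_set ?S x U) > 0}"
  fix W assume "openin ?\<tau> W \<and> W \<noteq> {}"
  then obtain u where W: "openin ?\<tau> W" and u: "u \<in> W" by blast
  obtain \<epsilon> where \<epsilon>: "\<epsilon> > 0"
    "\<And>v. v \<in> (\<Pi>\<^sub>E i\<in>{..<n}. X) \<Longrightarrow> (\<And>i. i < n \<Longrightarrow> dist (u i) (v i) < \<epsilon>) \<Longrightarrow> v \<in> W"
    using openin_sum_topology_n_contains_box[OF W u] by blast
  have uX: "u i \<in> X" if "i < n" for i
    using openin_subset[OF W] u that by (auto simp: topspace_sum_topology_n)
  have "\<exists>c M. i < n \<longrightarrow> c \<in> X \<and> dist (u i) c < \<epsilon> / 2 \<and> finite_measure M \<and> sets M = sets ball_algebra \<and>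
      distr M M T = M \<and> emeasure M (X \<inter> cball c (\<epsilon> / 4)) > 0" for i
  proof (cases "i < n")
    case True
    let ?RR = "{x \<in> topspace (top_of_set X). \<forall>U. x \<in> top_of_set X interior_of U \<longrightarrow>
      upper_Banach_dens (return_set T x U) > 0}"
    have dense: "dense_in (top_of_set X) ?RR" using rr unfolding reiteratively_recurrent_def .
    obtain c where c: "c \<in> ?RR" "c \<in> X" "dist (u i) c < \<epsilon> / 2"
      using dense_in_top_of_set_approx[OF dense uX[OF True] half_gt_zero[OF \<epsilon>(1)]] .
    have "c \<in> top_of_set X interior_of (X \<inter> cball c (\<epsilon> / 4))"
      unfolding interior_of_def
      using c(2) \<epsilon>(1) by (auto intro!: exI[of _ "X \<inter> ball c (\<epsilon> / 4)"] openin_open_Int)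
    then have "upper_Banach_dens (return_set T c (X \<inter> cball c (\<epsilon> / 4))) > 0" using c(1) by blast
    then obtain M where "finite_measure M" "sets M = sets ball_algebra" "distr M M T = M"
      "emeasure M (X \<inter> cball c (\<epsilon> / 4)) > 0"
      using invariant_measure_exists[OF c(2) c(2)] by blast
    then show ?thesis using c by blast
  qed auto
  then obtain c M' where M': "\<And>i. i < n \<Longrightarrow> c i \<in> X \<and> dist (u i) (c i) < \<epsilon> / 2 \<and> finite_measure (M' i) \<and>
      sets (M' i) = sets ball_algebra \<and> distr (M' i) (M' i) T = M' i \<and>
      emeasure (M' i) (X \<inter> cball (c i) (\<epsilon> / 4)) > 0" by metis
  \<comment> \<open>Product measures need a measure at every index; the indices from \<open>n\<close> on get the null measure.\<close>
  define M where "M i = (if i < n then M' i else null_measure ball_algebra)" for i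
  have fin: "finite_measure (M i)" for i
    using M' by (auto simp: M_def intro!: finite_measureI)
  have setsM: "sets (M i) = sets ball_algebra" for i using M' by (auto simp: M_def)
  have inv: "distr (M i) (M i) T = M i" if "i < n" for i using M'[OF that] that by (simp add: M_def)
  have spM: "space (M i) = X" for i using sets_eq_imp_space_eq[OF setsM[of i]] by simp
  have prod: "?S \<in> measurable (PiM {..<n} M) (PiM {..<n} M)"
    "distr (PiM {..<n} M) (PiM {..<n} M) ?S = PiM {..<n} M" "finite_measure (PiM {..<n} M)"
    by (rule sum_operator_n_preserves_product_measure[OF fin setsM]; erule inv)+
  interpret P: finite_measure "PiM {..<n} M" by (rule prod(3))
  interpret product_sigma_finite M
    unfolding product_sigma_finite_def using finite_measure.axioms(1)[OF fin] by blast
  obtain B where B: "countable B" "\<And>b. b \<in> B \<Longrightarrow> openin ?\<tau> b"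
    "\<And>b. b \<in> B \<Longrightarrow> \<exists>f. b = (\<Pi>\<^sub>E i\<in>{..<n}. f i) \<and> (\<forall>i<n. openin (top_of_set X) (f i))"
    "\<And>U u. openin ?\<tau> U \<Longrightarrow> u \<in> U \<Longrightarrow> \<exists>b\<in>B. u \<in> b \<and> b \<subseteq> U"
    using countable_box_base[of n] by blast
  have ae: "AE y in PiM {..<n} M. \<forall>b\<in>B. y \<in> b \<longrightarrow> lower_dens (return_set ?S y b) > 0"
    unfolding AE_ball_countable[OF B(1)]
  proof
    fix b assume "b \<in> B"
    then obtain f where f: "b = (\<Pi>\<^sub>E i\<in>{..<n}. f i)" "\<And>i. i < n \<Longrightarrow> openin (top_of_set X) (f i)"
      using B(3) by blast
    have "b \<in> sets (PiM {..<n} M)"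
      unfolding f(1) by (intro sets_PiM_I_finite) (auto simp: setsM intro!: openin_in_ball_algebra f(2))
    then show "AE y in PiM {..<n} M. y \<in> b \<longrightarrow> lower_dens (return_set ?S y b) > 0"
      by (rule P.AE_lower_dens_return_set_pos[OF prod(1,2)])
  qed
  obtain N where N:
    "{y \<in> space (PiM {..<n} M). \<not> (\<forall>b\<in>B. y \<in> b \<longrightarrow> lower_dens (return_set ?S y b) > 0)} \<subseteq> N"
    "emeasure (PiM {..<n} M) N = 0" "N \<in> sets (PiM {..<n} M)"
    by (rule AE_E[OF ae])
  let ?V = "\<Pi>\<^sub>E i\<in>{..<n}. X \<inter> cball (c i) (\<epsilon> / 4)"
  have "emeasure (PiM {..<n} M) ?V = (\<Prod>i<n. emeasure (M i) (X \<inter> cball (c i) (\<epsilon> / 4)))"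
    by (rule emeasure_PiM) (use M' in \<open>auto simp: setsM intro!: cball_in_ball_algebra\<close>)
  also have "\<dots> = ennreal (\<Prod>i<n. measure (M i) (X \<inter> cball (c i) (\<epsilon> / 4)))"
    by (simp add: finite_measure.emeasure_eq_measure[OF fin] prod_ennreal)
  also have "\<dots> \<noteq> 0"
  proof -
    have "measure (M i) (X \<inter> cball (c i) (\<epsilon> / 4)) > 0" if "i < n" for i
      using M'[OF that] finite_measure.emeasure_eq_measure[OF fin[of i], of "X \<inter> cball (c i) (\<epsilon> / 4)"] that
      by (simp add: M_def)
    then have "\<forall>i\<in>{..<n}. measure (M i) (X \<inter> cball (c i) (\<epsilon> / 4)) > 0" by simp
    then have "(\<Prod>i<n. measure (M i) (X \<inter> cball (c i) (\<epsilon> / 4))) > 0"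
      by (intro prod_pos) blast
    then show ?thesis unfolding ennreal_eq_0_iff not_le .
  qed
  finally have "emeasure (PiM {..<n} M) ?V \<noteq> 0" .
  then have "\<not> ?V \<subseteq> N" using emeasure_mono[OF _ N(3), of ?V] N(2) by auto
  then obtain y where y: "y \<in> ?V" "y \<notin> N" by blast
  have yX: "y \<in> (\<Pi>\<^sub>E i\<in>{..<n}. X)" using y(1) by (auto simp: PiE_iff)
  have yB: "lower_dens (return_set ?S y b) > 0" if "b \<in> B" "y \<in> b" for b
  proof -
    have "y \<in> space (PiM {..<n} M)" using yX by (simp add: space_PiM spM)
    then show ?thesis using N(1) y(2) that by blast
  qed
  have "y \<in> W"
  proof (rule \<epsilon>(2)[OF yX])
    fix i assume i: "i < n"
    have "y i \<in> X \<inter> cball (c i) (\<epsilon> / 4)" by (rule PiE_mem[OF y(1)]) (simp add: i)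
    then have "dist (c i) (y i) \<le> \<epsilon> / 4" by simp
    moreover have "dist (u i) (c i) < \<epsilon> / 2" using M'[OF i] by simp
    ultimately show "dist (u i) (y i) < \<epsilon>"
      using dist_triangle[of "u i" "y i" "c i"] \<epsilon>(1) by linarith
  qed
  moreover have "y \<in> ?R"
  proof (intro CollectI conjI allI impI)
    show "y \<in> topspace ?\<tau>" using yX by (simp add: topspace_sum_topology_n)
    fix U assume "y \<in> ?\<tau> interior_of U"
    then obtain b where b: "b \<in> B" "y \<in> b" "b \<subseteq> ?\<tau> interior_of U"
      using B(4)[OF openin_interior_of, of y U] by blast
    have "b \<subseteq> U" by (rule order_trans[OF b(3) interior_of_subset])
    have "0 < lower_dens (return_set ?S y b)" by (rule yB[OF b(1,2)])
    also have "\<dots> \<le> lower_dens (return_set ?S y U)"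
      by (rule lower_dens_mono[OF return_set_mono[OF \<open>b \<subseteq> U\<close>]])
    finally show "lower_dens (return_set ?S y U) > 0" .
  qed
  ultimately show "?R \<inter> W \<noteq> {}" by blast
qed auto

end

section \<open>Upper frequent hypercyclicity of the direct sums\<close>

text \<open>That \<open>\<delta>\<close> may depend on \<open>V\<close> but not on \<open>U\<close> makes the vectors visiting \<open>V\<close> with rate at least
  \<open>\<delta>\<close> infinitely often a dense \<open>G\<^sub>\<delta>\<close> set: a finite number of visits to an open set
  persists under small perturbations.\<close>
lemma U_frequently_hypercyclicI_Baire:
  assumes cm: "completely_metrizable_space \<tau>" and ne: "topspace \<tau> \<noteq> {}"
    and B: "countable B" "\<And>b. b \<in> B \<Longrightarrow> openin \<tau> b"
      "\<And>U u. openin \<tau> U \<Longrightarrow> u \<in> U \<Longrightarrow> \<exists>b\<in>B. u \<in> b \<and> b \<subseteq> U"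
    and S: "continuous_map \<tau> \<tau> S"
    and crit: "\<And>V. openin \<tau> V \<Longrightarrow> V \<noteq> {} \<Longrightarrow> \<exists>\<delta>>0. \<forall>U. openin \<tau> U \<and> U \<noteq> {} \<longrightarrow>
      (\<exists>x\<in>U. \<forall>N0. \<exists>N\<ge>N0. \<delta> * real (N + 1) \<le> real (card (return_set S x V \<inter> {0..N})))"
  shows "U_frequently_hypercyclic \<tau> S"
proof -
  define B' where "B' = B - {{}}"
  have B': "openin \<tau> b" "b \<noteq> {}" if "b \<in> B'" for b using that B(2) by (auto simp: B'_def)
  have "\<forall>b\<in>B'. \<exists>\<delta>>0. \<forall>U. openin \<tau> U \<and> U \<noteq> {} \<longrightarrow>
      (\<exists>x\<in>U. \<forall>N0. \<exists>N\<ge>N0. \<delta> * real (N + 1) \<le> real (card (return_set S x b \<inter> {0..N})))"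
    by (intro ballI crit B')
  then obtain \<delta> where \<delta>_all: "\<forall>b\<in>B'. \<delta> b > 0 \<and> (\<forall>U. openin \<tau> U \<and> U \<noteq> {} \<longrightarrow>
      (\<exists>x\<in>U. \<forall>N0. \<exists>N\<ge>N0. \<delta> b * real (N + 1) \<le> real (card (return_set S x b \<inter> {0..N}))))"
    by (rule exE[OF bchoice])
  have \<delta>: "\<delta> b > 0" if "b \<in> B'" for b using bspec[OF \<delta>_all that] by (rule conjunct1)
  have \<delta>_dense: "\<exists>x\<in>U. \<forall>N0. \<exists>N\<ge>N0. \<delta> b * real (N + 1) \<le> real (card (return_set S x b \<inter> {0..N}))"
    if "b \<in> B'" "openin \<tau> U" "U \<noteq> {}" for b U
    using conjunct2[OF bspec[OF \<delta>_all that(1)], rule_format, OF conjI[OF that(2,3)]] by simp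
  define G where "G b N0 = {x \<in> topspace \<tau>. \<exists>N\<ge>N0. \<delta> b * real (N + 1) \<le> real (card (return_set S x b \<inter> {0..N}))}"
    for b and N0 :: nat
  have Sk: "continuous_map \<tau> \<tau> (S ^^ k)" for k
  proof (induction k)
    case (Suc k)
    then show ?case using continuous_map_compose[OF Suc S] by (simp only: funpow.simps(2))
  qed (simp add: id_def)
  have G_open: "openin \<tau> (G b N0)" if b: "b \<in> B'" for b N0
  proof (subst openin_subopen, intro ballI)
    fix x assume "x \<in> G b N0"
    then obtain N where x: "x \<in> topspace \<tau>" and N: "N \<ge> N0"
      "\<delta> b * real (N + 1) \<le> real (card (return_set S x b \<inter> {0..N}))"
      by (auto simp: G_def)
    define F where "F = return_set S x b \<inter> {0..N}"
    define W where "W = topspace \<tau> \<inter> (\<Inter>k\<in>F. {y \<in> topspace \<tau>. (S ^^ k) y \<in> b})"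
    have "openin \<tau> W"
    proof (cases "F = {}")
      case False
      then have "openin \<tau> (\<Inter>k\<in>F. {y \<in> topspace \<tau>. (S ^^ k) y \<in> b})"
        using openin_continuous_map_preimage[OF Sk B'(1)[OF b]] by (intro openin_INT2) (auto simp: F_def)
      then show ?thesis unfolding W_def by (intro openin_Int) auto
    qed (simp add: W_def)
    moreover have "x \<in> W" using x by (auto simp: W_def F_def return_set_def)
    moreover have "W \<subseteq> G b N0"
    proof
      fix y assume y: "y \<in> W"
      have "F \<subseteq> return_set S y b \<inter> {0..N}"
        using y by (auto simp: W_def F_def return_set_def)
      then have "card F \<le> card (return_set S y b \<inter> {0..N})" by (intro card_mono) auto
      then have "\<delta> b * real (N + 1) \<le> real (card (return_set S y b \<inter> {0..N}))"
        using N(2) unfolding F_def[symmetric] by linarith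
      then show "y \<in> G b N0" using y N(1) by (auto simp: G_def W_def)
    qed
    ultimately show "\<exists>T. openin \<tau> T \<and> x \<in> T \<and> T \<subseteq> G b N0" by blast
  qed
  have G_dense: "\<tau> closure_of (G b N0) = topspace \<tau>" if b: "b \<in> B'" for b N0
  proof -
    have "G b N0 \<inter> U \<noteq> {}" if U: "openin \<tau> U" "U \<noteq> {}" for U
    proof -
      obtain x where x: "x \<in> U"
        "\<forall>N0. \<exists>N\<ge>N0. \<delta> b * real (N + 1) \<le> real (card (return_set S x b \<inter> {0..N}))"
        using \<delta>_dense[OF b U] by blast
      then have "x \<in> G b N0" using openin_subset[OF U(1)] unfolding G_def by blast
      then show ?thesis using x(1) by blast
    qed
    then show ?thesis unfolding dense_intersects_open by blast
  qed
  let ?\<G> = "(\<lambda>(b, N0). G b N0) ` (B' \<times> UNIV)"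
  have "\<tau> closure_of (\<Inter>?\<G>) = topspace \<tau>"
  proof (rule Baire_category)
    show "countable ?\<G>" using B(1) by (auto simp: B'_def)
  qed (use cm G_open G_dense in auto)
  then have "\<Inter>?\<G> \<noteq> {}" using ne closure_of_empty by metis
  then obtain x where x: "\<And>b N0. b \<in> B' \<Longrightarrow> x \<in> G b N0" by auto
  obtain t where "t \<in> topspace \<tau>" using ne by blast
  then obtain b0 where "b0 \<in> B'" using B(3)[OF openin_topspace] by (auto simp: B'_def)
  then have "x \<in> topspace \<tau>" using x[of b0 0] by (simp add: G_def)
  moreover have "upper_dens (return_set S x U) > 0" if U: "openin \<tau> U" "U \<noteq> {}" for U
  proof -
    obtain b where b: "b \<in> B'" "b \<subseteq> U" using B(3)[OF U(1)] U(2) by (fastforce simp: B'_def)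
    have "ereal (\<delta> b) \<le> upper_dens (return_set S x U)"
      unfolding upper_dens_def
    proof (rule ccontr)
      assume "\<not> ereal (\<delta> b) \<le> limsup (\<lambda>N. ereal (real (card (return_set S x U \<inter> {0..N})) / real (N + 1)))"
      then have "eventually (\<lambda>N. ereal (real (card (return_set S x U \<inter> {0..N})) / real (N + 1)) < ereal (\<delta> b)) sequentially"
        by (intro Limsup_lessD) simp
      then obtain N0 where N0: "\<And>N. N \<ge> N0 \<Longrightarrow>
          real (card (return_set S x U \<inter> {0..N})) / real (N + 1) < \<delta> b"
        by (auto simp: eventually_sequentially)
      obtain N where N: "N \<ge> N0" "\<delta> b * real (N + 1) \<le> real (card (return_set S x b \<inter> {0..N}))"
        using x[OF b(1), of N0] by (auto simp: G_def)
      have "card (return_set S x b \<inter> {0..N}) \<le> card (return_set S x U \<inter> {0..N})"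
        using return_set_mono[OF b(2)] by (intro card_mono) auto
      then have "\<delta> b \<le> real (card (return_set S x U \<inter> {0..N})) / real (N + 1)"
        using N(2) by (subst pos_le_divide_eq) auto
      then show False using N0[OF N(1)] by simp
    qed
    then show ?thesis using \<delta>[OF b(1)] by (auto intro: less_le_trans[rotated])
  qed
  ultimately show ?thesis unfolding U_frequently_hypercyclic_def by blast
qed

text \<open>Discarding an initial segment costs a bounded number of elements, which half of the lower
  density absorbs. The bound \<open>\<delta>\<close> does not depend on where the segment ends.\<close>
lemma lower_dens_pos_imp_card_shifted:
  assumes "lower_dens A > 0"
  obtains \<delta> :: real where "\<delta> > 0"
    "\<And>K B N0. A \<inter> {K..} \<subseteq> B \<Longrightarrow> \<exists>N\<ge>N0. \<delta> * real (N + 1) \<le> real (card (B \<inter> {0..N}))"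
proof -
  obtain c where c: "0 < ereal c" "ereal c < lower_dens A" using ereal_dense2[OF assms] by blast
  show thesis
  proof (rule that[of "c / 2"])
    show "c / 2 > 0" using c(1) by simp
    fix K N0 :: nat and B assume AB: "A \<inter> {K..} \<subseteq> B"
    have "eventually (\<lambda>N. ereal c < ereal (real (card (A \<inter> {0..N})) / real (N + 1))) sequentially"
      using c(2) unfolding lower_dens_def by (rule less_LiminfD)
    then obtain N1 where N1: "\<And>N. N \<ge> N1 \<Longrightarrow> c < real (card (A \<inter> {0..N})) / real (N + 1)"
      by (auto simp: eventually_sequentially)
    obtain m :: nat where m: "real K < real m * (c / 2)"
      using reals_Archimedean3[of "c / 2"] c(1) by auto
    define N where "N = N0 + N1 + m"
    have "c * real (N + 1) < real (card (A \<inter> {0..N}))"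
      using N1[of N] by (simp add: N_def field_simps)
    also have "card (A \<inter> {0..N}) \<le> card ((B \<inter> {0..N}) \<union> {..<K})"
      using AB by (intro card_mono) (auto simp: not_less)
    also have "\<dots> \<le> card (B \<inter> {0..N}) + K"
      using card_Un_le[of "B \<inter> {0..N}" "{..<K}"] by simp
    finally have "c * real (N + 1) < real (card (B \<inter> {0..N}) + K)" by simp
    moreover have "real m * (c / 2) \<le> real (N + 1) * (c / 2)"
      using c(1) by (intro mult_right_mono) (auto simp: N_def)
    ultimately have "c / 2 * real (N + 1) \<le> real (card (B \<inter> {0..N}))"
      using m by (simp add: algebra_simps)
    then show "\<exists>N\<ge>N0. c / 2 * real (N + 1) \<le> real (card (B \<inter> {0..N}))"
      by (intro exI[of _ N]) (simp add: N_def)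
  qed
qed

lemma frequently_recurrent_vector_in_open:
  assumes "frequently_recurrent \<tau> S" "openin \<tau> V" "V \<noteq> {}"
  obtains y where "y \<in> V" "lower_dens (return_set S y V) > 0"
proof -
  obtain y where y: "y \<in> V" "\<And>U. y \<in> \<tau> interior_of U \<Longrightarrow> lower_dens (return_set S y U) > 0"
    using assms unfolding frequently_recurrent_def dense_in_iff by blast
  have "y \<in> \<tau> interior_of V" using y(1) assms(2) by (simp add: interior_of_openin)
  then show thesis using that y by blast
qed

context compact_functional_system
begin

lemma continuous_map_sum_operator_n:
  "continuous_map (sum_topology_n n (top_of_set X)) (sum_topology_n n (top_of_set X)) (sum_operator_n n T)"
  unfolding sum_topology_n_def sum_operator_n_def
proof (subst continuous_map_componentwise, intro conjI ballI)
  have TX: "continuous_map (top_of_set X) (top_of_set X) T"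
    using T_in_X linear_continuous_on[OF bounded_linear_T] by (auto simp: continuous_map_subtopology_eu)
  show "continuous_map (product_topology (\<lambda>_. top_of_set X) {..<n}) (top_of_set X)
      (\<lambda>x. (\<lambda>i\<in>{..<n}. T (x i)) k)" if "k \<in> {..<n}" for k
    using continuous_map_compose[OF continuous_map_product_projection[OF that] TX] that
    by (simp add: comp_def)
qed auto

lemma completely_metrizable_sum_topology_n:
  "completely_metrizable_space (sum_topology_n n (top_of_set X))"
proof -
  have "completely_metrizable_space (top_of_set X)"
    using closed_X by (intro completely_metrizable_space_closedin completely_metrizable_space_euclidean) auto
  then show ?thesis
    unfolding sum_topology_n_def completely_metrizable_space_product_topology
    by (auto intro!: uncountable_infinite countable_finite)
qed

text \<open>The vectors required by Baire's theorem are \<open>y + a\<close>, where \<open>y\<close> returns to a box of half the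
  size inside \<open>V\<close> and \<open>a\<close> has coordinates in \<open>X0\<close>. The other half of the size absorbs the orbit of
  \<open>a\<close> once it is small.\<close>
lemma sum_operator_n_U_frequently_hypercyclic:
  assumes fr: "frequently_recurrent (sum_topology_n n (top_of_set X)) (sum_operator_n n T)"
    and X0: "dense_in (top_of_set X) X0" "\<And>x. x \<in> X0 \<Longrightarrow> (\<lambda>k. (T ^^ k) x) \<longlonglongrightarrow> 0"
  shows "U_frequently_hypercyclic (sum_topology_n n (top_of_set X)) (sum_operator_n n T)"
proof -
  let ?\<tau> = "sum_topology_n n (top_of_set X)" and ?S = "sum_operator_n n T"
  have linT: "linear ((T ^^ k))" for k
  proof (induction k)
    case (Suc k)
    then show ?case
      using linear_compose[OF Suc bounded_linear.linear[OF bounded_linear_T]]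
      by (simp only: funpow.simps(2))
  qed (simp only: funpow.simps(1) linear_id)
  obtain B where B: "countable B" "\<And>b. b \<in> B \<Longrightarrow> openin ?\<tau> b"
    "\<And>b. b \<in> B \<Longrightarrow> \<exists>f. b = (\<Pi>\<^sub>E i\<in>{..<n}. f i) \<and> (\<forall>i<n. openin (top_of_set X) (f i))"
    "\<And>U u. openin ?\<tau> U \<Longrightarrow> u \<in> U \<Longrightarrow> \<exists>b\<in>B. u \<in> b \<and> b \<subseteq> U"
    using countable_box_base[of n] by blast
  show ?thesis
  proof (rule U_frequently_hypercyclicI_Baire[OF completely_metrizable_sum_topology_n _ B(1,2,4) continuous_map_sum_operator_n])
    show "topspace ?\<tau> \<noteq> {}"
      using subspace_0[OF subspace_X] by (auto simp: topspace_sum_topology_n PiE_eq_empty_iff)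
  next
    fix V assume V: "openin ?\<tau> V" "V \<noteq> {}"
    then obtain v where v: "v \<in> V" by blast
    obtain \<epsilon> where \<epsilon>: "\<epsilon> > 0"
      "\<And>w. w \<in> (\<Pi>\<^sub>E i\<in>{..<n}. X) \<Longrightarrow> (\<And>i. i < n \<Longrightarrow> dist (v i) (w i) < \<epsilon>) \<Longrightarrow> w \<in> V"
      using openin_sum_topology_n_contains_box[OF V(1) v] by blast
    let ?box = "\<Pi>\<^sub>E i\<in>{..<n}. X \<inter> ball (v i) (\<epsilon> / 2)"
    have "v \<in> ?box"
      using openin_subset[OF V(1)] v \<epsilon>(1) by (auto simp: topspace_sum_topology_n PiE_iff)
    then obtain y where y: "y \<in> ?box" "lower_dens (return_set ?S y ?box) > 0"
      using frequently_recurrent_vector_in_open[OF fr openin_box] by blast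
    have yX: "y \<in> (\<Pi>\<^sub>E i\<in>{..<n}. X)" using y(1) by (auto simp: PiE_iff)
    obtain \<delta> :: real where \<delta>: "\<delta> > 0"
      "\<And>K B N0. return_set ?S y ?box \<inter> {K..} \<subseteq> B \<Longrightarrow> \<exists>N\<ge>N0. \<delta> * real (N + 1) \<le> real (card (B \<inter> {0..N}))"
      using lower_dens_pos_imp_card_shifted[OF y(2)] by blast
    show "\<exists>\<delta>>0. \<forall>U. openin ?\<tau> U \<and> U \<noteq> {} \<longrightarrow>
      (\<exists>x\<in>U. \<forall>N0. \<exists>N\<ge>N0. \<delta> * real (N + 1) \<le> real (card (return_set ?S x V \<inter> {0..N})))"
    proof (intro exI[of _ \<delta>] conjI allI impI)
      fix U assume "openin ?\<tau> U \<and> U \<noteq> {}"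
      then obtain u where U: "openin ?\<tau> U" and u: "u \<in> U" by blast
      obtain \<rho> where \<rho>: "\<rho> > 0"
        "\<And>w. w \<in> (\<Pi>\<^sub>E i\<in>{..<n}. X) \<Longrightarrow> (\<And>i. i < n \<Longrightarrow> dist (u i) (w i) < \<rho>) \<Longrightarrow> w \<in> U"
        using openin_sum_topology_n_contains_box[OF U u] by blast
      have "\<exists>a. a \<in> X0 \<and> a \<in> X \<and> dist (u i - y i) a < \<rho>" if "i < n" for i
      proof -
        have "u i \<in> X" "y i \<in> X"
          using openin_subset[OF U] u yX that by (auto simp: topspace_sum_topology_n)
        then have "u i - y i \<in> X" by (rule subspace_diff[OF subspace_X])
        then show ?thesis using dense_in_top_of_set_approx[OF X0(1) _ \<rho>(1)] by metis
      qed
      then obtain a where a: "\<And>i. i < n \<Longrightarrow> a i \<in> X0 \<and> a i \<in> X \<and> dist (u i - y i) (a i) < \<rho>" by metis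
      define x where "x = (\<lambda>i\<in>{..<n}. y i + a i)"
      have xX: "x \<in> (\<Pi>\<^sub>E i\<in>{..<n}. X)"
        using yX a subspace_add[OF subspace_X] by (auto simp: x_def PiE_iff)
      have "x \<in> U"
        by (rule \<rho>(2)[OF xX]) (use a in \<open>auto simp: x_def dist_norm algebra_simps\<close>)
      have "eventually (\<lambda>k. \<forall>i\<in>{..<n}. dist ((T ^^ k) (a i)) 0 < \<epsilon> / 2) sequentially"
        using X0(2) a \<epsilon>(1) by (intro eventually_ball_finite ballI tendstoD) auto
      then obtain K where K: "\<And>k i. k \<ge> K \<Longrightarrow> i < n \<Longrightarrow> norm ((T ^^ k) (a i)) < \<epsilon> / 2"
        by (auto simp: eventually_sequentially)
      have "return_set ?S y ?box \<inter> {K..} \<subseteq> return_set ?S x V"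
      proof
        fix k assume k: "k \<in> return_set ?S y ?box \<inter> {K..}"
        have "(?S ^^ k) x \<in> V"
        proof (rule \<epsilon>(2))
          show "(?S ^^ k) x \<in> (\<Pi>\<^sub>E i\<in>{..<n}. X)"
            using xX funpow_T_in_X by (auto simp: sum_operator_n_funpow[OF xX] PiE_iff)
          fix i assume i: "i < n"
          have "dist (v i) ((T ^^ k) (y i)) < \<epsilon> / 2"
            using k i by (auto simp: return_set_sum_operator_n[OF yX])
          moreover have "norm ((T ^^ k) (a i)) < \<epsilon> / 2" using K k i by auto
          moreover have "(T ^^ k) (x i) = (T ^^ k) (y i) + (T ^^ k) (a i)"
            using i linear_add[OF linT] by (simp add: x_def)
          moreover have "dist (v i) ((T ^^ k) (y i) + (T ^^ k) (a i))
              \<le> dist (v i) ((T ^^ k) (y i)) + norm ((T ^^ k) (a i))"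
            using norm_triangle_ineq4[of "v i - (T ^^ k) (y i)" "(T ^^ k) (a i)"]
            by (simp add: dist_norm algebra_simps)
          ultimately show "dist (v i) ((?S ^^ k) x i) < \<epsilon>"
            using i by (simp add: sum_operator_n_funpow[OF xX])
        qed
        then show "k \<in> return_set ?S x V" by (simp add: return_set_def)
      qed
      then show "\<exists>x\<in>U. \<forall>N0. \<exists>N\<ge>N0. \<delta> * real (N + 1) \<le> real (card (return_set ?S x V \<inter> {0..N}))"
        using \<delta>(2) \<open>x \<in> U\<close> by blast
    qed (rule \<delta>(1))
  qed
qed

end

section \<open>The equivalence\<close>

lemma lower_dens_le_upper_Banach_dens: "lower_dens A \<le> upper_Banach_dens A"
proof -
  have "lower_dens A \<le> limsup (\<lambda>N. ereal (real (card (A \<inter> {0..N})) / real (N + 1)))"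
    unfolding lower_dens_def by (rule Liminf_le_Limsup) simp
  also have "\<dots> \<le> upper_Banach_dens A"
    unfolding upper_Banach_dens_def
  proof (intro Limsup_mono always_eventually allI)
    fix N
    show "ereal (real (card (A \<inter> {0..N})) / real (N + 1))
        \<le> (SUP m. ereal (real (card (A \<inter> {m..m + N})) / real (N + 1)))"
      by (rule SUP_upper2[of 0]) auto
  qed
  finally show ?thesis .
qed

lemma reiteratively_recurrent_if_frequently_recurrent_sum_1:
  assumes fr: "frequently_recurrent (sum_topology_n 1 \<tau>) (sum_operator_n 1 T)"
  shows "reiteratively_recurrent \<tau> T"
  unfolding reiteratively_recurrent_def dense_in_iff
proof (intro conjI allI impI)
  let ?R = "{x \<in> topspace \<tau>. \<forall>U. x \<in> \<tau> interior_of U \<longrightarrow> upper_Banach_dens (return_set T x U) > 0}"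
  fix W assume "openin \<tau> W \<and> W \<noteq> {}"
  then have W: "openin \<tau> W" "W \<noteq> {}" by auto
  let ?R1 = "{x \<in> topspace (sum_topology_n 1 \<tau>). \<forall>U. x \<in> sum_topology_n 1 \<tau> interior_of U \<longrightarrow>
    lower_dens (return_set (sum_operator_n 1 T) x U) > 0}"
  have "openin (sum_topology_n 1 \<tau>) (\<Pi>\<^sub>E i\<in>{..<1}. W)" by (rule openin_sum_topology_n_box) (rule W)
  moreover have "(\<Pi>\<^sub>E i\<in>{..<1::nat}. W) \<noteq> {}" using W(2) by (simp add: PiE_eq_empty_iff)
  ultimately obtain y where y: "y \<in> ?R1" "y \<in> (\<Pi>\<^sub>E i\<in>{..<1}. W)"
    using fr unfolding frequently_recurrent_def dense_in_iff by blast
  have "y 0 \<in> W" using y(2) by auto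
  have yX: "y \<in> (\<Pi>\<^sub>E i\<in>{..<1}. topspace \<tau>)" using y(1) by (simp add: sum_topology_n_def)
  have "upper_Banach_dens (return_set T (y 0) U) > 0" if U: "y 0 \<in> \<tau> interior_of U" for U
  proof -
    let ?V = "\<Pi>\<^sub>E i\<in>{..<1::nat}. \<tau> interior_of U"
    have "openin (sum_topology_n 1 \<tau>) ?V" by (rule openin_sum_topology_n_box) simp
    moreover have "y \<in> ?V" using U yX by (auto simp: PiE_iff)
    ultimately have "y \<in> sum_topology_n 1 \<tau> interior_of ?V" by (simp add: interior_of_openin)
    then have "0 < lower_dens (return_set (sum_operator_n 1 T) y ?V)" using y(1) by blast
    also have "\<dots> \<le> lower_dens (return_set T (y 0) U)"
    proof (rule lower_dens_mono, unfold return_set_sum_operator_n[OF yX], rule subsetI)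
      fix k assume "k \<in> {k. \<forall>i<1. (T ^^ k) (y i) \<in> \<tau> interior_of U}"
      then have "(T ^^ k) (y 0) \<in> \<tau> interior_of U" by simp
      then show "k \<in> return_set T (y 0) U"
        using subsetD[OF interior_of_subset] by (simp add: return_set_def)
    qed
    also have "\<dots> \<le> upper_Banach_dens (return_set T (y 0) U)"
      by (rule lower_dens_le_upper_Banach_dens)
    finally show ?thesis .
  qed
  then have "y 0 \<in> ?R" using openin_subset[OF W(1)] \<open>y 0 \<in> W\<close> by blast
  then show "?R \<inter> W \<noteq> {}" using \<open>y 0 \<in> W\<close> by blast
qed auto

lemma (in compact_functional_system) recurrence_equivalence:
  assumes "dense_in (top_of_set X) X0" "\<And>x. x \<in> X0 \<Longrightarrow> (\<lambda>k. (T ^^ k) x) \<longlonglongrightarrow> 0"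
  shows "(\<forall>n\<ge>1. U_frequently_hypercyclic (sum_topology_n n (top_of_set X)) (sum_operator_n n T) \<and>
             frequently_recurrent (sum_topology_n n (top_of_set X)) (sum_operator_n n T))
      \<longleftrightarrow> reiteratively_recurrent (top_of_set X) T"
    (is "?L \<longleftrightarrow> ?R")
proof
  assume ?L
  then have "frequently_recurrent (sum_topology_n 1 (top_of_set X)) (sum_operator_n 1 T)" by blast
  then show ?R by (rule reiteratively_recurrent_if_frequently_recurrent_sum_1)
next
  assume ?R
  then have fr: "frequently_recurrent (sum_topology_n n (top_of_set X)) (sum_operator_n n T)" for n
    by (rule sum_operator_n_frequently_recurrent)
  show ?L
    using fr sum_operator_n_U_frequently_hypercyclic[OF fr assms] by blast
qed

section \<open>The scalar field\<close>

text \<open>The scalar field is isometric to a closed subset of the complex numbers. Completeness of the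
  scalars makes spaces of bounded functionals Banach spaces.\<close>
instance real_or_complex \<subseteq> heine_borel
proof
  fix f :: "nat \<Rightarrow> 'a" assume bd: "bounded (range f)"
  obtain \<phi> :: "'a \<Rightarrow> complex" where \<phi>: "\<And>a b. \<phi> (a + b) = \<phi> a + \<phi> b" "\<And>a. norm (\<phi> a) = norm a"
    "range \<phi> = \<real> \<or> range \<phi> = UNIV"
    using real_or_complex_embedding by blast
  have diff: "\<phi> (a - b) = \<phi> a - \<phi> b" for a b
    using \<phi>(1)[of "a - b" b] by (simp add: algebra_simps)
  have "bounded (range (\<phi> \<circ> f))"
    using bd by (auto simp: bounded_iff \<phi>(2))
  then obtain L r where r: "strict_mono r" "((\<phi> \<circ> f) \<circ> r) \<longlonglongrightarrow> L"
    using bounded_imp_convergent_subsequence by blast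
  have "closed (range \<phi>)" using \<phi>(3) by (auto simp: closed_complex_Reals)
  then have "L \<in> range \<phi>"
    using closed_sequentially[OF _ _ r(2), of "range \<phi>"] by auto
  then obtain l where l: "L = \<phi> l" by blast
  have "(\<lambda>k. norm (f (r k) - l)) \<longlonglongrightarrow> 0"
    using tendsto_norm_zero[OF LIM_zero[OF r(2)]] by (simp add: l comp_def \<phi>(2) flip: diff)
  then have "(f \<circ> r) \<longlonglongrightarrow> l"
    by (simp add: comp_def tendsto_norm_zero_iff LIM_zero_iff)
  then show "\<exists>l r. strict_mono r \<and> (f \<circ> r) \<longlonglongrightarrow> l" using r(1) by blast
qed

instance real_or_complex \<subseteq> banach ..

lemma real_or_complex_cases:
  obtains (real) "\<And>c :: 'k::real_or_complex. \<exists>r. c = of_real r"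
  | (complex) I :: "'k::real_or_complex" where "I * I = -1" "\<And>c. \<exists>a b. c = of_real a + of_real b * I"
      "\<And>a b. \<bar>a\<bar> \<le> norm (of_real a + of_real b * I)"
proof -
  obtain \<phi> :: "'k \<Rightarrow> complex" where \<phi>: "\<And>a b. \<phi> (a + b) = \<phi> a + \<phi> b"
    "\<And>a b. \<phi> (a * b) = \<phi> a * \<phi> b" "\<And>r a. \<phi> (r *\<^sub>R a) = r *\<^sub>R \<phi> a" "\<And>a. norm (\<phi> a) = norm a"
    "range \<phi> = \<real> \<or> range \<phi> = UNIV"
    using real_or_complex_embedding by blast
  have diff: "\<phi> (a - b) = \<phi> a - \<phi> b" for a b
    using \<phi>(1)[of "a - b" b] by (simp add: algebra_simps)
  have inj: "a = b" if "\<phi> a = \<phi> b" for a b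
    using \<phi>(4)[of "a - b"] that by (simp add: diff)
  have "\<phi> 1 * \<phi> 1 = \<phi> 1" using \<phi>(2)[of 1 1] by simp
  moreover have "\<phi> 1 \<noteq> 0" using \<phi>(4)[of 1] by auto
  ultimately have "\<phi> 1 = 1" by simp
  then have of_real: "\<phi> (of_real r) = of_real r" for r
    using \<phi>(3)[of r 1] by (simp add: of_real_def)
  from \<phi>(5) show thesis
  proof
    assume R: "range \<phi> = \<real>"
    have "\<exists>r. c = of_real r" for c :: 'k
    proof -
      have "\<phi> c \<in> \<real>" using R by blast
      then obtain r where "\<phi> c = of_real r" by (auto elim: Reals_cases)
      then have "c = of_real r" by (intro inj) (simp add: of_real)
      then show ?thesis ..
    qed
    then show thesis by (rule real)
  next
    assume R: "range \<phi> = UNIV"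
    then obtain I where I: "\<phi> I = \<i>" by (metis UNIV_I imageE)
    have ab: "\<phi> (of_real a + of_real b * I) = Complex a b" for a b
      by (simp add: \<phi>(1,2) of_real I complex_eq_iff)
    show thesis
    proof (rule complex)
      show "I * I = -1"
      proof (rule inj)
        have "\<phi> (-1) = -1" using of_real[of "-1"] by simp
        then show "\<phi> (I * I) = \<phi> (-1)" by (simp add: \<phi>(2) I)
      qed
      show "\<exists>a b. c = of_real a + of_real b * I" for c :: 'k
        by (intro exI[of _ "Re (\<phi> c)"] exI[of _ "Im (\<phi> c)"] inj) (simp add: ab)
      show "\<bar>a\<bar> \<le> norm (of_real a + of_real b * I)" for a b
        using abs_Re_le_cmod[of "Complex a b"] by (simp add: ab flip: \<phi>(4))
    qed
  qed
qed

section \<open>Norming functionals\<close>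

text \<open>Asking only for \<open>q (c x) \<le> c q x\<close> with \<open>c > 0\<close> is enough: applying this to \<open>1 / c\<close> gives
  equality, and \<open>q 0 = 0\<close> follows.\<close>
definition sublinear :: "('v::real_vector \<Rightarrow> real) \<Rightarrow> bool" where
  "sublinear q \<longleftrightarrow> (\<forall>x y. q (x + y) \<le> q x + q y) \<and> (\<forall>c x. 0 < c \<longrightarrow> q (c *\<^sub>R x) \<le> c * q x)"

lemma sublinear_add: "sublinear q \<Longrightarrow> q (x + y) \<le> q x + q y"
  by (simp add: sublinear_def)

lemma sublinear_scaleR: "sublinear q \<Longrightarrow> 0 < c \<Longrightarrow> q (c *\<^sub>R x) = c * q x"
proof (rule antisym)
  assume q: "sublinear q" "0 < c"
  then show "q (c *\<^sub>R x) \<le> c * q x" by (simp add: sublinear_def)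
  have "q (inverse c *\<^sub>R (c *\<^sub>R x)) \<le> inverse c * q (c *\<^sub>R x)"
    using q unfolding sublinear_def by (metis positive_imp_inverse_positive)
  then show "c * q x \<le> q (c *\<^sub>R x)" using q(2) by (simp add: field_simps)
qed

lemma sublinear_0: "sublinear q \<Longrightarrow> q 0 = 0"
  using sublinear_scaleR[of q 2 0] by simp

lemma sublinear_uminus: "sublinear q \<Longrightarrow> - q (- x) \<le> q x"
  using sublinear_add[of q x "- x"] sublinear_0[of q] by simp

text \<open>The functional \<open>q x = inf {p (x + t x0) - t p x0 | t \<ge> 0}\<close> is sublinear, lies below \<open>p\<close> and is
  odd in the direction of \<open>x0\<close>. This single construction serves twice: minimal sublinear
  functionals are seen to be linear, and a functional below it attains \<open>p x0\<close> at \<open>x0\<close>.\<close>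
lemma sublinear_shrink:
  fixes p :: "'v::real_vector \<Rightarrow> real"
  assumes p: "sublinear p"
  obtains q where "sublinear q" "\<And>x. q x \<le> p x" "q (- x0) \<le> - p x0"
proof -
  define V where "V x = (\<lambda>t. p (x + t *\<^sub>R x0) - t * p x0) ` {0..}" for x
  define q where "q x = Inf (V x)" for x
  have pt: "p (t *\<^sub>R x0) = t * p x0" if "t \<ge> 0" for t
    using that sublinear_scaleR[OF p, of t x0] sublinear_0[OF p] by (cases "t = 0") auto
  have "- p (- x) \<le> p (x + t *\<^sub>R x0) - t * p x0" if "t \<ge> 0" for x t
    using sublinear_add[OF p, of "x + t *\<^sub>R x0" "- x"] pt[OF that] by simp
  then have bdd: "bdd_below (V x)" for x unfolding V_def bdd_below_def by fastforce
  have le: "q x \<le> p (x + t *\<^sub>R x0) - t * p x0" if "t \<ge> 0" for x t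
    unfolding q_def by (rule cInf_lower[OF _ bdd]) (use that in \<open>auto simp: V_def\<close>)
  have ge: "b \<le> q x" if "\<And>t. t \<ge> 0 \<Longrightarrow> b \<le> p (x + t *\<^sub>R x0) - t * p x0" for x b
    unfolding q_def by (rule cInf_greatest) (use that in \<open>auto simp: V_def\<close>)
  show thesis
  proof (rule that)
    show "q x \<le> p x" for x using le[of 0 x] by simp
    show "q (- x0) \<le> - p x0" using le[of 1 "- x0"] sublinear_0[OF p] by simp
    show "sublinear q"
      unfolding sublinear_def
    proof (intro conjI allI impI)
      fix x y
      have "q (x + y) - (p (y + t *\<^sub>R x0) - t * p x0) \<le> q x" if t: "t \<ge> 0" for t
      proof (rule ge)
        fix s :: real assume s: "s \<ge> 0"
        have "q (x + y) \<le> p (x + y + (s + t) *\<^sub>R x0) - (s + t) * p x0" using le s t by simp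
        also have "x + y + (s + t) *\<^sub>R x0 = (x + s *\<^sub>R x0) + (y + t *\<^sub>R x0)"
          by (simp add: algebra_simps)
        finally show "q (x + y) - (p (y + t *\<^sub>R x0) - t * p x0) \<le> p (x + s *\<^sub>R x0) - s * p x0"
          using sublinear_add[OF p, of "x + s *\<^sub>R x0" "y + t *\<^sub>R x0"] by (simp add: algebra_simps)
      qed
      then have "q (x + y) - q x \<le> q y" by (intro ge) (simp add: algebra_simps)
      then show "q (x + y) \<le> q x + q y" by simp
    next
      fix c :: real and x assume c: "0 < c"
      have "q (c *\<^sub>R x) / c \<le> q x"
      proof (rule ge)
        fix t :: real assume t: "t \<ge> 0"
        have "q (c *\<^sub>R x) \<le> p (c *\<^sub>R x + (c * t) *\<^sub>R x0) - (c * t) * p x0" using le c t by simp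
        also have "c *\<^sub>R x + (c * t) *\<^sub>R x0 = c *\<^sub>R (x + t *\<^sub>R x0)" by (simp add: algebra_simps)
        also have "p (c *\<^sub>R (x + t *\<^sub>R x0)) = c * p (x + t *\<^sub>R x0)" by (rule sublinear_scaleR[OF p c])
        finally show "q (c *\<^sub>R x) / c \<le> p (x + t *\<^sub>R x0) - t * p x0"
          using c by (simp add: field_simps)
      qed
      then show "q (c *\<^sub>R x) \<le> c * q x" using c by (simp add: field_simps)
    qed
  qed
qed

text \<open>The Hahn-Banach theorem, by taking a minimal sublinear functional below \<open>p\<close>. Infima of chains
  stay finite because \<open>q x \<ge> - q (- x) \<ge> - p (- x)\<close>.\<close>
lemma linear_functional_below_sublinear:
  fixes p :: "'v::real_vector \<Rightarrow> real"
  assumes p: "sublinear p"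
  obtains u where "linear u" "\<And>x. u x \<le> p x"
proof -
  define A where "A = {q. sublinear q \<and> q \<le> p}"
  have "\<exists>m\<in>A. \<forall>a\<in>A. m \<ge> a \<longrightarrow> a = m"
  proof (rule predicate_Zorn)
    show "partial_order_on A (relation_of (\<ge>) A)"
      by (rule partial_order_on_relation_ofI) auto
    fix C assume C: "C \<in> Chains (relation_of (\<ge>) A)"
    then have CA: "C \<subseteq> A" and chain: "\<And>x y. x \<in> C \<Longrightarrow> y \<in> C \<Longrightarrow> x \<le> y \<or> y \<le> x"
      by (auto simp: Chains_def relation_of_def)
    show "\<exists>u\<in>A. \<forall>a\<in>C. a \<ge> u"
    proof (cases "C = {}")
      case True
      then show ?thesis using p by (auto simp: A_def)
    next
      case False
      define u where "u x = (INF q\<in>C. q x)" for x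
      have lower: "- p (- x) \<le> q x" if "q \<in> C" for q x
      proof -
        have q: "sublinear q" "q (- x) \<le> p (- x)" using that CA by (auto simp: A_def le_fun_def)
        then show ?thesis using sublinear_uminus[OF q(1), of x] by linarith
      qed
      have u_le: "u x \<le> q x" if "q \<in> C" for q x
        unfolding u_def by (rule cINF_lower) (use that lower in \<open>auto intro!: bdd_belowI2\<close>)
      have u_ge: "b \<le> u x" if "\<And>q. q \<in> C \<Longrightarrow> b \<le> q x" for b x
        unfolding u_def by (rule cINF_greatest[OF False]) (rule that)
      have "sublinear u"
        unfolding sublinear_def
      proof (intro conjI allI impI)
        fix x y
        have "u (x + y) - q2 y \<le> u x" if q2: "q2 \<in> C" for q2
        proof (rule u_ge)
          fix q1 assume q1: "q1 \<in> C"
          obtain q where q: "q \<in> C" "q \<le> q1" "q \<le> q2" using chain[OF q1 q2] q1 q2 by blast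
          then have "sublinear q" using CA by (auto simp: A_def)
          have "u (x + y) \<le> q (x + y)" by (rule u_le[OF q(1)])
          also have "\<dots> \<le> q x + q y" by (rule sublinear_add[OF \<open>sublinear q\<close>])
          also have "\<dots> \<le> q1 x + q2 y" using q(2,3) by (intro add_mono) (auto simp: le_fun_def)
          finally show "u (x + y) - q2 y \<le> q1 x" by simp
        qed
        then have "u (x + y) - u x \<le> u y" by (intro u_ge) (simp add: algebra_simps)
        then show "u (x + y) \<le> u x + u y" by simp
      next
        fix c :: real and x assume c: "0 < c"
        have "u (c *\<^sub>R x) / c \<le> u x"
        proof (rule u_ge)
          fix q assume q: "q \<in> C"
          then have "sublinear q" using CA by (auto simp: A_def)
          then show "u (c *\<^sub>R x) / c \<le> q x"
            using u_le[OF q, of "c *\<^sub>R x"] c by (simp add: sublinear_scaleR field_simps)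
        qed
        then show "u (c *\<^sub>R x) \<le> c * u x" using c by (simp add: field_simps)
      qed
      moreover have "u \<le> p"
      proof -
        obtain q where "q \<in> C" using False by blast
        then have "u \<le> q" "q \<le> p" using u_le CA by (auto simp: le_fun_def A_def)
        then show ?thesis by (rule order_trans)
      qed
      ultimately show ?thesis using u_le by (auto simp: A_def le_fun_def)
    qed
  qed
  then obtain m where m: "sublinear m" "m \<le> p"
    and min: "\<And>q. sublinear q \<Longrightarrow> q \<le> p \<Longrightarrow> q \<le> m \<Longrightarrow> q = m"
    by (auto simp: A_def)
  have uminus: "m (- x) = - m x" for x
  proof -
    obtain q where q: "sublinear q" "\<And>x. q x \<le> m x" "q (- x) \<le> - m x"
      using sublinear_shrink[OF m(1)] by blast
    have "q \<le> m" using q(2) by (simp add: le_fun_def)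
    then have "q = m" using q(1) m(2) by (intro min) auto
    then have "m (- x) \<le> - m x" using q(3) by simp
    then show ?thesis using sublinear_uminus[OF m(1), of x] by simp
  qed
  have "linear m"
  proof (rule linearI)
    fix x y
    have "- m (x + y) \<le> - m x - m y"
      using sublinear_add[OF m(1), of "- x" "- y"] uminus[of "x + y"] by (simp add: uminus)
    then show "m (x + y) = m x + m y" using sublinear_add[OF m(1), of x y] by simp
  next
    fix c :: real and x
    have pos: "m (c *\<^sub>R x) = c * m x" if "c > 0" for c x by (rule sublinear_scaleR[OF m(1) that])
    consider "c > 0" | "c = 0" | "- c > 0" by linarith
    then show "m (c *\<^sub>R x) = c *\<^sub>R m x"
    proof cases
      case 3
      then show ?thesis using pos[of "- c" x] uminus[of "c *\<^sub>R x"] by simp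
    qed (use pos sublinear_0[OF m(1)] in auto)
  qed
  then show thesis using that m(2) by (auto simp: le_fun_def)
qed

lemma real_norming_functional:
  fixes x0 :: "'v::real_normed_vector"
  obtains u :: "'v \<Rightarrow> real" where "linear u" "\<And>x. \<bar>u x\<bar> \<le> norm x" "u x0 = norm x0"
proof -
  have "sublinear (norm :: 'v \<Rightarrow> real)" by (simp add: sublinear_def norm_triangle_ineq)
  then obtain q where q: "sublinear q" "\<And>x. q x \<le> norm x" "q (- x0) \<le> - norm x0"
    using sublinear_shrink by blast
  obtain u where u: "linear u" "\<And>x. u x \<le> q x"
    using linear_functional_below_sublinear[OF q(1)] by blast
  have le: "u x \<le> norm x" for x using u(2) q(2) order_trans by blast
  have bd: "\<bar>u x\<bar> \<le> norm x" for x
    using le[of x] le[of "- x"] linear_neg[OF u(1), of x] by simp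
  have "- u x0 \<le> - norm x0" using u(2)[of "- x0"] q(3) linear_neg[OF u(1), of x0] by simp
  then have "u x0 = norm x0" using le[of x0] by simp
  then show thesis using that u(1) bd by blast
qed

text \<open>Over the complex field a real functional \<open>u\<close> is the real part of
  \<open>g x = u x - i u (i x)\<close>, which is complex linear. Rotating \<open>x\<close> until \<open>g x\<close> is real and
  nonnegative shows that \<open>g\<close> is bounded by the same norm.\<close>
lemma norming_functional:
  fixes smul :: "'k::real_or_complex \<Rightarrow> 'x::banach \<Rightarrow> 'x"
  assumes smul: "banach_over smul"
  obtains f where "f \<in> dual_space smul" "\<And>x. norm (blinfun_apply f x) \<le> norm x"
    "norm (blinfun_apply f x0) \<ge> norm x0"
proof -
  have vs: "vector_space smul" and of_real: "\<And>r x. smul (of_real r) x = r *\<^sub>R x"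
    and norm: "\<And>c x. norm (smul c x) = norm c * norm x"
    using smul by (auto simp: banach_over_def)
  interpret vector_space smul by (rule vs)
  obtain u :: "'x \<Rightarrow> real" where u: "linear u" "\<And>x. \<bar>u x\<bar> \<le> norm x" "u x0 = norm x0"
    using real_norming_functional[of x0] by blast
  have "\<exists>g :: 'x \<Rightarrow> 'k. (\<forall>x y. g (x + y) = g x + g y) \<and> (\<forall>c x. g (smul c x) = c * g x) \<and>
    (\<forall>x. norm (g x) \<le> norm x) \<and> norm (g x0) \<ge> norm x0"
  proof (cases rule: real_or_complex_cases[where 'k = 'k])
    case real
    have hom: "of_real (u (smul c x)) = c * of_real (u x)" for c x
    proof -
      obtain r where "c = of_real r" using real by blast
      then show ?thesis by (simp add: of_real linear_cmul[OF u(1)])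
    qed
    show ?thesis
      by (rule exI[of _ "\<lambda>x. of_real (u x)"]) (auto simp: linear_add[OF u(1)] u(2,3) hom)
  next
    case (complex I)
    define g where "g x = of_real (u x) - of_real (u (smul I x)) * I" for x
    have g_add: "g (x + y) = g x + g y" for x y
      by (simp add: g_def linear_add[OF u(1)] scale_right_distrib algebra_simps)
    have g_real: "g (r *\<^sub>R x) = of_real r * g x" for r x
    proof -
      have "smul I (r *\<^sub>R x) = r *\<^sub>R smul I x"
        by (simp add: scale_scale mult.commute flip: of_real)
      then show ?thesis by (simp add: g_def linear_cmul[OF u(1)] algebra_simps)
    qed
    have g_I: "g (smul I x) = I * g x" for x
    proof -
      have "smul I (smul I x) = - x"
        using complex(1) by (simp add: scale_scale scale_minus_left)
      then have "g (smul I x) = of_real (u (smul I x)) + of_real (u x) * I"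
        by (simp add: g_def linear_neg[OF u(1)])
      also have "\<dots> = I * g x"
      proof -
        have "I * g x = of_real (u x) * I - of_real (u (smul I x)) * (I * I)"
          by (simp add: g_def algebra_simps)
        then show ?thesis by (simp add: complex(1))
      qed
      finally show ?thesis .
    qed
    have g_hom: "g (smul c x) = c * g x" for c x
    proof -
      obtain a b where c: "c = of_real a + of_real b * I" using complex(2) by blast
      have "smul c x = a *\<^sub>R x + b *\<^sub>R smul I x"
        by (simp add: c scale_left_distrib flip: scale_scale of_real)
      then show ?thesis by (simp add: g_add g_real g_I c algebra_simps)
    qed
    have re_le: "\<bar>u x - r\<bar> \<le> norm (g x - of_real r)" for x r
      using complex(3)[of "u x - r" "- u (smul I x)"] by (simp add: g_def algebra_simps)
    have g_le: "norm (g x) \<le> norm x" for x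
    proof (cases "g x = 0")
      case False
      define c where "c = of_real (norm (g x)) / g x"
      have "norm c = 1" using False by (simp add: c_def norm_divide)
      have "g (smul c x) = of_real (norm (g x))" using False by (simp add: g_hom c_def)
      then have "u (smul c x) = norm (g x)" using re_le[of "smul c x" "norm (g x)"] by simp
      then show ?thesis using u(2)[of "smul c x"] \<open>norm c = 1\<close> by (simp add: norm)
    qed simp
    have "norm (g x0) \<ge> norm x0" using re_le[of x0 0] u(3) by simp
    then show ?thesis using g_add g_hom g_le by blast
  qed
  then obtain g :: "'x \<Rightarrow> 'k" where g: "\<And>x y. g (x + y) = g x + g y" "\<And>c x. g (smul c x) = c * g x"
    "\<And>x. norm (g x) \<le> norm x" "norm (g x0) \<ge> norm x0"
    by blast
  have "bounded_linear g"
  proof (rule bounded_linear_intro[where K = 1])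
    show "g (r *\<^sub>R x) = r *\<^sub>R g x" for r x
      using g(2)[of "of_real r" x] by (simp add: of_real scaleR_conv_of_real)
  qed (use g in auto)
  then have "blinfun_apply (Blinfun g) = g" by (rule bounded_linear_Blinfun_apply)
  then show thesis using that[of "Blinfun g"] g by (simp add: dual_space_def)
qed

section \<open>Dual spaces and reflexive spaces\<close>

text \<open>Weak-star compactness of balls: the pointwise limit of bounded functionals along an ultrafilter
  is again a functional with the same bound. Composing the evaluation at \<open>y\<close>
  with the adjoint gives the evaluation at \<open>S y\<close>.\<close>
lemma dual_space_compact_functional_system:
  fixes smul :: "'k::real_or_complex \<Rightarrow> 'y::banach \<Rightarrow> 'y" and S :: "'y \<Rightarrow>\<^sub>L 'y"
  assumes S: "operator_over smul S"
    and sep: "separable_space (top_of_set (dual_space smul))"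
  shows "compact_functional_system (dual_space smul) (adjoint_operator S)
    (range (\<lambda>y (f :: 'y \<Rightarrow>\<^sub>L 'k). blinfun_apply f y))"
proof (rule compact_functional_system.intro)
  have "dual_space smul = (\<Inter>c y. {f :: 'y \<Rightarrow>\<^sub>L 'k. blinfun_apply f (smul c y) = c * blinfun_apply f y})"
    by (auto simp: dual_space_def)
  also have "closed \<dots>"
    by (intro closed_INT ballI closed_Collect_eq continuous_intros)
  finally show "closed (dual_space smul :: ('y \<Rightarrow>\<^sub>L 'k) set)" .
  show "subspace (dual_space smul :: ('y \<Rightarrow>\<^sub>L 'k) set)"
    by (auto simp: subspace_def dual_space_def blinfun.add_left blinfun.scaleR_left algebra_simps)
  show "bounded_linear (adjoint_operator S :: ('y \<Rightarrow>\<^sub>L 'k) \<Rightarrow> _)"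
    unfolding adjoint_operator_def
    by (rule bounded_bilinear.bounded_linear_left[OF bounded_bilinear_blinfun_compose])
  show "adjoint_operator S f \<in> dual_space smul" if "f \<in> dual_space smul" for f :: "'y \<Rightarrow>\<^sub>L 'k"
    using that S by (simp add: dual_space_def adjoint_operator_def operator_over_def)
  show "separable_space (top_of_set (dual_space smul :: ('y \<Rightarrow>\<^sub>L 'k) set))" by (rule sep)
  show "linear e" if "e \<in> range (\<lambda>y (f :: 'y \<Rightarrow>\<^sub>L 'k). blinfun_apply f y)" for e
    using that by (auto intro!: linearI simp: blinfun.add_left blinfun.scaleR_left)
  show "(\<lambda>f. e (adjoint_operator S f)) \<in> range (\<lambda>y (f :: 'y \<Rightarrow>\<^sub>L 'k). blinfun_apply f y)"
    if "e \<in> range (\<lambda>y (f :: 'y \<Rightarrow>\<^sub>L 'k). blinfun_apply f y)" for e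
    using that by (auto simp: adjoint_operator_def)
next
  fix f :: "'y \<Rightarrow>\<^sub>L 'k" and r assume r: "r < norm f"
  have "\<exists>y. norm y \<le> 1 \<and> r < norm (blinfun_apply f y)"
  proof (cases "r < 0")
    case True
    then show ?thesis by (intro exI[of _ 0]) simp
  next
    case False
    then obtain y where y: "r * norm y < norm (blinfun_apply f y)"
      using norm_blinfun_bound[of r f] r by (meson not_le)
    then have "y \<noteq> 0" by auto
    then show ?thesis
      using y by (intro exI[of _ "inverse (norm y) *\<^sub>R y"])
        (simp add: blinfun.scaleR_right field_simps)
  qed
  then obtain y where y: "norm y \<le> 1" "r < norm (blinfun_apply f y)" by blast
  have "norm (blinfun_apply g y) \<le> norm g" for g :: "'y \<Rightarrow>\<^sub>L 'k"
    using norm_blinfun[of g y] mult_left_mono[OF y(1), of "norm g"] by simp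
  then show "\<exists>e\<in>range (\<lambda>y (f :: 'y \<Rightarrow>\<^sub>L 'k). blinfun_apply f y).
      (\<forall>g\<in>dual_space smul. norm (e g) \<le> norm g) \<and> r < norm (e f)"
    using y(2) by (intro bexI[of _ "\<lambda>f. blinfun_apply f y"]) auto
next
  fix p :: "nat filter" and x :: "nat \<Rightarrow> 'y \<Rightarrow>\<^sub>L 'k" and R
  assume p: "ultrafilter p" and x: "\<And>k. x k \<in> dual_space smul"
    and R: "eventually (\<lambda>k. norm (x k) \<le> R) p"
  have pbot: "p \<noteq> bot" using p by (simp add: ultrafilter_def)
  have ev: "eventually (\<lambda>k. norm (blinfun_apply (x k) y) \<le> norm y * R) p" for y
    using R
  proof eventually_elim
    case (elim k)
    then show ?case
      using norm_blinfun[of "x k" y] mult_right_mono[OF elim norm_ge_zero[of y]]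
      by (simp add: mult.commute)
  qed
  have "\<exists>l. ((\<lambda>k. blinfun_apply (x k) y) \<longlongrightarrow> l) p" for y
    by (rule ultrafilter_convergent[OF p compact_cball[of 0 "norm y * R"], of "\<lambda>k. blinfun_apply (x k) y"])
      (use ev in auto)
  then obtain g where g: "\<And>y. ((\<lambda>k. blinfun_apply (x k) y) \<longlongrightarrow> g y) p" by metis
  have "bounded_linear g"
  proof (rule bounded_linear_intro)
    show "g (y + z) = g y + g z" for y z
      using tendsto_unique[OF pbot g] tendsto_add[OF g g] by (simp add: blinfun.add_right)
    show "g (r *\<^sub>R y) = r *\<^sub>R g y" for r y
      using tendsto_unique[OF pbot g] tendsto_scaleR[OF tendsto_const g] by (simp add: blinfun.scaleR_right)
    show "norm (g y) \<le> norm y * R" for y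
      by (rule tendsto_upperbound[OF tendsto_norm[OF g] ev pbot])
  qed
  then have apply_g: "blinfun_apply (Blinfun g) = g" by (rule bounded_linear_Blinfun_apply)
  have "g (smul c y) = c * g y" for c y
  proof (rule tendsto_unique[OF pbot g])
    show "((\<lambda>k. blinfun_apply (x k) (smul c y)) \<longlongrightarrow> c * g y) p"
      using x tendsto_mult[OF tendsto_const g, of c y] by (simp add: dual_space_def)
  qed
  then show "\<exists>l\<in>dual_space smul. \<forall>e\<in>range (\<lambda>y (f :: 'y \<Rightarrow>\<^sub>L 'k). blinfun_apply f y).
      ((\<lambda>k. e (x k)) \<longlongrightarrow> e l) p"
    using g by (intro bexI[of _ "Blinfun g"]) (auto simp: apply_g dual_space_def)
qed

text \<open>The limits of \<open>f (x k)\<close> along an ultrafilter define an element of the bidual, which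
  reflexivity represents by a vector of the space.\<close>
lemma reflexive_compact_functional_system:
  fixes smul :: "'k::real_or_complex \<Rightarrow> 'x::banach \<Rightarrow> 'x" and T :: "'x \<Rightarrow>\<^sub>L 'x"
  assumes smul: "banach_over smul" and T: "operator_over smul T"
    and refl: "reflexive_space smul" and sep: "separable_space (euclidean :: 'x topology)"
  shows "compact_functional_system UNIV (blinfun_apply T) (blinfun_apply ` dual_space smul)"
proof (rule compact_functional_system.intro)
  show "separable_space (top_of_set (UNIV :: 'x set))" using sep by simp
  show "bounded_linear (blinfun_apply T)" by (rule blinfun.bounded_linear_right)
  show "linear e" if "e \<in> blinfun_apply ` dual_space smul" for e
    using that by (auto intro!: linearI simp: blinfun.add_right blinfun.scaleR_right)
  show "(\<lambda>x. e (blinfun_apply T x)) \<in> blinfun_apply ` dual_space smul"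
    if e: "e \<in> blinfun_apply ` dual_space smul" for e
  proof -
    obtain f where f: "e = blinfun_apply f" "f \<in> dual_space smul" using e by blast
    then have "f o\<^sub>L T \<in> dual_space smul"
      using T by (simp add: dual_space_def operator_over_def)
    moreover have "(\<lambda>x. e (blinfun_apply T x)) = blinfun_apply (f o\<^sub>L T)" by (auto simp: f(1))
    ultimately show ?thesis by blast
  qed
next
  fix x :: 'x and r assume "r < norm x"
  then show "\<exists>e\<in>blinfun_apply ` dual_space smul. (\<forall>y\<in>UNIV. norm (e y) \<le> norm y) \<and> r < norm (e x)"
    using norming_functional[OF smul, of x] by (metis imageI less_le_trans)
next
  fix p :: "nat filter" and x :: "nat \<Rightarrow> 'x" and R
  assume p: "ultrafilter p" and R: "eventually (\<lambda>k. norm (x k) \<le> R) p"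
  have pbot: "p \<noteq> bot" using p by (simp add: ultrafilter_def)
  have ev: "eventually (\<lambda>k. norm (blinfun_apply f (x k)) \<le> R * norm f) p" for f :: "'x \<Rightarrow>\<^sub>L 'k"
    using R
  proof eventually_elim
    case (elim k)
    then show ?case
      using norm_blinfun[of f "x k"] mult_right_mono[OF elim norm_ge_zero[of f]]
      by (simp add: mult.commute)
  qed
  have "\<exists>l. ((\<lambda>k. blinfun_apply f (x k)) \<longlongrightarrow> l) p" for f :: "'x \<Rightarrow>\<^sub>L 'k"
    by (rule ultrafilter_convergent[OF p compact_cball[of 0 "R * norm f"], of "\<lambda>k. blinfun_apply f (x k)"])
      (use ev in auto)
  then obtain \<Phi> where \<Phi>: "\<And>f :: 'x \<Rightarrow>\<^sub>L 'k. ((\<lambda>k. blinfun_apply f (x k)) \<longlongrightarrow> \<Phi> f) p" by metis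
  have "bidual_functional smul \<Phi>"
    unfolding bidual_functional_def
  proof (intro conjI ballI allI exI[of _ R])
    show "\<Phi> (f + g) = \<Phi> f + \<Phi> g" for f g
      using tendsto_unique[OF pbot \<Phi>] tendsto_add[OF \<Phi> \<Phi>] by (simp add: blinfun.add_left)
    show "\<Phi> (blinfun_mult_right c o\<^sub>L f) = c * \<Phi> f" for c f
      using tendsto_unique[OF pbot \<Phi>] tendsto_mult[OF tendsto_const \<Phi>]
      by (simp add: blinfun_mult_right.rep_eq)
    show "norm (\<Phi> f) \<le> R * norm f" for f
      by (rule tendsto_upperbound[OF tendsto_norm[OF \<Phi>] ev pbot])
  qed
  then obtain l where l: "\<And>f. f \<in> dual_space smul \<Longrightarrow> \<Phi> f = blinfun_apply f l"
    using refl unfolding reflexive_space_def by blast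
  have "((\<lambda>k. e (x k)) \<longlongrightarrow> e l) p" if e: "e \<in> blinfun_apply ` dual_space smul" for e
  proof -
    obtain f where f: "e = blinfun_apply f" "f \<in> dual_space smul" using e by blast
    show ?thesis using \<Phi>[of f] unfolding f(1) l[OF f(2)] .
  qed
  then show "\<exists>l\<in>UNIV. \<forall>e\<in>blinfun_apply ` dual_space smul. ((\<lambda>k. e (x k)) \<longlongrightarrow> e l) p" by blast
qed auto

theorem theorem5p6:
  fixes smulY :: "'k::real_or_complex \<Rightarrow> 'y::banach \<Rightarrow> 'y"
    and S :: "'y \<Rightarrow>\<^sub>L 'y"
    and smulX :: "'k \<Rightarrow> 'x::banach \<Rightarrow> 'x"
    and T :: "'x \<Rightarrow>\<^sub>L 'x"
  shows
    "(let X = top_of_set (dual_space smulY); R = adjoint_operator S in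
        banach_over smulY \<and> operator_over smulY S \<and> separable_space X \<and>
        (\<exists>X0. dense_in X X0 \<and> (\<forall>x\<in>X0. limitin X (\<lambda>k. (R ^^ k) x) 0 sequentially)) \<longrightarrow>
        ((\<forall>n\<ge>1. U_frequently_hypercyclic (sum_topology_n n X) (sum_operator_n n R) \<and>
                frequently_recurrent (sum_topology_n n X) (sum_operator_n n R))
         \<longleftrightarrow> reiteratively_recurrent X R))
     \<and>
     (let X = (euclidean :: 'x topology); R = blinfun_apply T in
        banach_over smulX \<and> operator_over smulX T \<and> reflexive_space smulX \<and>
        separable_space X \<and>
        (\<exists>X0. dense_in X X0 \<and> (\<forall>x\<in>X0. limitin X (\<lambda>k. (R ^^ k) x) 0 sequentially)) \<longrightarrow>
        ((\<forall>n\<ge>1. U_frequently_hypercyclic (sum_topology_n n X) (sum_operator_n n R) \<and>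
                frequently_recurrent (sum_topology_n n X) (sum_operator_n n R))
         \<longleftrightarrow> reiteratively_recurrent X R))"
  unfolding Let_def
proof (intro conjI impI; elim conjE exE)
  fix X0
  assume S: "operator_over smulY S" "separable_space (top_of_set (dual_space smulY :: ('y \<Rightarrow>\<^sub>L 'k) set))"
    and X0: "dense_in (top_of_set (dual_space smulY)) X0"
      "\<forall>x\<in>X0. limitin (top_of_set (dual_space smulY)) (\<lambda>k. (adjoint_operator S ^^ k) x) 0 sequentially"
  interpret compact_functional_system "dual_space smulY" "adjoint_operator S"
      "range (\<lambda>y (f :: 'y \<Rightarrow>\<^sub>L 'k). blinfun_apply f y)"
    by (rule dual_space_compact_functional_system[OF S])
  show "(\<forall>n\<ge>1. U_frequently_hypercyclic (sum_topology_n n (top_of_set (dual_space smulY)))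
            (sum_operator_n n (adjoint_operator S)) \<and>
          frequently_recurrent (sum_topology_n n (top_of_set (dual_space smulY)))
            (sum_operator_n n (adjoint_operator S)))
      \<longleftrightarrow> reiteratively_recurrent (top_of_set (dual_space smulY)) (adjoint_operator S)"
    using X0 by (intro recurrence_equivalence) (auto simp: limitin_subtopology)
next
  fix X0
  assume T: "banach_over smulX" "operator_over smulX T" "reflexive_space smulX"
      "separable_space (euclidean :: 'x topology)"
    and X0: "dense_in euclidean X0"
      "\<forall>x\<in>X0. limitin euclidean (\<lambda>k. (blinfun_apply T ^^ k) x) 0 sequentially"
  interpret compact_functional_system UNIV "blinfun_apply T" "blinfun_apply ` dual_space smulX"
    by (rule reflexive_compact_functional_system[OF T])
  show "(\<forall>n\<ge>1. U_frequently_hypercyclic (sum_topology_n n euclidean) (sum_operator_n n (blinfun_apply T)) \<and>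
          frequently_recurrent (sum_topology_n n euclidean) (sum_operator_n n (blinfun_apply T)))
      \<longleftrightarrow> reiteratively_recurrent euclidean (blinfun_apply T)"
    using recurrence_equivalence X0 by (simp add: limitin_canonical_iff)
qed

end
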